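(* Let $T=M_wEM_u$ be a bounded WCT operator on the Orlicz space $L^\Phi(\Sigma)$ such that $\mathcal{R}(T^2)$ is closed. Then $\mathcal{R}(T^2)\cap\mathcal{N}(T^2)=\{0\}$ and $\mathcal{R}(T^2)+\mathcal{N}(T^2)$ is dense in $L^\Phi(\mu)$.
   Context: $(X,\Sigma,\mu)$ is a complete $\sigma$-finite measure space; functions are complex-valued, identified when equal $\mu$-a.e. A Young function is a convex even function $\Phi:\mathbb{R}\to[0,\infty]$ with $\Phi(0)=0$, neither identically $0$ nor identically $\infty$ on $(0,\infty)$, and left-continuous at $b_\Phi=\sup\{x>0:\Phi(x)<\infty\}$. For a measurable function $f$, $\Phi(f)$ means $\Phi(|f|)$. $\Phi$ is a Young function and $L^\Phi(\mu)=L^\Phi(\Sigma)=\{f \text{ measurable}: \exists k>0,\ \int_X\Phi(kf)\,d\mu<\infty\}$ is the Orlicz space, a Banach space with norm $N_\Phi(f)=\inf\{k>0:\int_X\Phi(f/k)\,d\mu\le1\}$. $\mathcal{A}\subseteq\Sigma$ is a sub-$\sigma$-algebra such that $\mu|_{\mathcal A}$ is $\sigma$-finite, and $E=E^{\mathcal A}$ is the conditional expectation: $E(f)$ is the unique $\mathcal A$-measurable function with $\int_A f\,d\mu=\int_A E(f)\,d\mu$ for $A\in\mathcal A$, defined for $f\ge0$ and extended by linearity to measurable $f$ with $E(|f|)<\infty$ a.e. For measurable $u,w:X\to\mathbb{C}$, the WCT (weighted conditional type) operator $T=M_wEM_u$ is $T(f)=wE(uf)$, where it is understood that $E(uw)$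 and $E(uf)$, $f\in L^\Phi(\mu)$, are defined. $\mathcal{N}(S)$ and $\mathcal{R}(S)$ denote the null space and range of $S$. *)

theory Defs
  imports "HOL-Analysis.Analysis" "HOL-Probability.Conditional_Expectation"
begin

section \<open>Young functions\<close>

definition young_bound :: "(real \<Rightarrow> ennreal) \<Rightarrow> ereal" where
  "young_bound \<Phi> = Sup (ereal ` {x. x > 0 \<and> \<Phi> x < \<infinity>})"

text \<open>
  The library's \<^const>\<open>convex_on\<close> is restricted to real-valued functions, so convexity of the
  extended-valued function is written out; in \<^typ>\<open>ennreal\<close> we have \<open>0 * \<infinity> = 0\<close>. Left-continuity at
  the bound is only a condition when that bound is finite.
\<close>

definition young_function :: "(real \<Rightarrow> ennreal) \<Rightarrow> bool" where
  "young_function \<Phi> \<longleftrightarrow>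
     (\<forall>x y. \<forall>t\<in>{0..1}. \<Phi> ((1 - t) * x + t * y) \<le> ennreal (1 - t) * \<Phi> x + ennreal t * \<Phi> y) \<and>
     (\<forall>x. \<Phi> (- x) = \<Phi> x) \<and>
     \<Phi> 0 = 0 \<and>
     (\<exists>x>0. \<Phi> x \<noteq> 0) \<and>
     (\<exists>x>0. \<Phi> x \<noteq> \<infinity>) \<and>
     (\<forall>b. ereal b = young_bound \<Phi> \<longrightarrow> continuous (at_left b) \<Phi>)"

section \<open>Functions modulo almost everywhere equality\<close>

definition ae_class :: "'a measure \<Rightarrow> ('a \<Rightarrow> complex) \<Rightarrow> ('a \<Rightarrow> complex) set" where
  "ae_class M f = {g \<in> borel_measurable M. AE x in M. g x = f x}"

definition ae_plus ::
    "'a measure \<Rightarrow> ('a \<Rightarrow> complex) set \<Rightarrow> ('a \<Rightarrow> complex) set \<Rightarrow> ('a \<Rightarrow> complex) set" where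
  "ae_plus M F G = (\<Union>f\<in>F. \<Union>g\<in>G. ae_class M (\<lambda>x. f x + g x))"

definition ae_minus ::
    "'a measure \<Rightarrow> ('a \<Rightarrow> complex) set \<Rightarrow> ('a \<Rightarrow> complex) set \<Rightarrow> ('a \<Rightarrow> complex) set" where
  "ae_minus M F G = (\<Union>f\<in>F. \<Union>g\<in>G. ae_class M (\<lambda>x. f x - g x))"

definition ae_zero :: "'a measure \<Rightarrow> ('a \<Rightarrow> complex) set" where
  "ae_zero M = ae_class M (\<lambda>x. 0)"

section \<open>Orlicz spaces\<close>

definition orlicz_modular :: "'a measure \<Rightarrow> (real \<Rightarrow> ennreal) \<Rightarrow> ('a \<Rightarrow> complex) \<Rightarrow> ennreal" where
  "orlicz_modular M \<Phi> f = (\<integral>\<^sup>+x. \<Phi> (cmod (f x)) \<partial>M)"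

definition orlicz_functions :: "'a measure \<Rightarrow> (real \<Rightarrow> ennreal) \<Rightarrow> ('a \<Rightarrow> complex) set" where
  "orlicz_functions M \<Phi> =
     {f \<in> borel_measurable M. \<exists>k>0. orlicz_modular M \<Phi> (\<lambda>x. complex_of_real k * f x) < \<infinity>}"

definition luxemburg_norm :: "'a measure \<Rightarrow> (real \<Rightarrow> ennreal) \<Rightarrow> ('a \<Rightarrow> complex) \<Rightarrow> real" where
  "luxemburg_norm M \<Phi> f = Inf {k. k > 0 \<and> orlicz_modular M \<Phi> (\<lambda>x. f x / complex_of_real k) \<le> 1}"

definition orlicz_space :: "'a measure \<Rightarrow> (real \<Rightarrow> ennreal) \<Rightarrow> ('a \<Rightarrow> complex) set set" where
  "orlicz_space M \<Phi> = ae_class M ` orlicz_functions M \<Phi>"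

text \<open>The lemma \<open>orlicz_norm_ae_class\<close> below shows that the norm does not depend on the representative.\<close>

definition orlicz_norm :: "'a measure \<Rightarrow> (real \<Rightarrow> ennreal) \<Rightarrow> ('a \<Rightarrow> complex) set \<Rightarrow> real" where
  "orlicz_norm M \<Phi> F = the_elem (luxemburg_norm M \<Phi> ` F)"

text \<open>
  \<^locale>\<open>Metric_space\<close> asks for nonnegativity and symmetry also outside the carrier; hence the
  default value \<open>0\<close>. The lemma \<open>Metric_space_orlicz\<close> below is the resulting instance.
\<close>

definition orlicz_dist ::
    "'a measure \<Rightarrow> (real \<Rightarrow> ennreal) \<Rightarrow> ('a \<Rightarrow> complex) set \<Rightarrow> ('a \<Rightarrow> complex) set \<Rightarrow> real" where
  "orlicz_dist M \<Phi> F G =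
     (if F \<in> orlicz_space M \<Phi> \<and> G \<in> orlicz_space M \<Phi> then orlicz_norm M \<Phi> (ae_minus M F G) else 0)"

definition orlicz_topology ::
    "'a measure \<Rightarrow> (real \<Rightarrow> ennreal) \<Rightarrow> ('a \<Rightarrow> complex) set topology" where
  "orlicz_topology M \<Phi> = Metric_space.mtopology (orlicz_space M \<Phi>) (orlicz_dist M \<Phi>)"

section \<open>Operators on Orlicz spaces\<close>

definition bounded_on_orlicz ::
    "'a measure \<Rightarrow> (real \<Rightarrow> ennreal) \<Rightarrow> (('a \<Rightarrow> complex) set \<Rightarrow> ('a \<Rightarrow> complex) set) \<Rightarrow> bool" where
  "bounded_on_orlicz M \<Phi> S \<longleftrightarrow>
     S ` orlicz_space M \<Phi> \<subseteq> orlicz_space M \<Phi> \<and>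
     (\<exists>C. \<forall>F\<in>orlicz_space M \<Phi>. orlicz_norm M \<Phi> (S F) \<le> C * orlicz_norm M \<Phi> F)"

definition orlicz_range ::
    "'a measure \<Rightarrow> (real \<Rightarrow> ennreal) \<Rightarrow> (('a \<Rightarrow> complex) set \<Rightarrow> ('a \<Rightarrow> complex) set) \<Rightarrow>
     ('a \<Rightarrow> complex) set set" where
  "orlicz_range M \<Phi> S = S ` orlicz_space M \<Phi>"

definition orlicz_null ::
    "'a measure \<Rightarrow> (real \<Rightarrow> ennreal) \<Rightarrow> (('a \<Rightarrow> complex) set \<Rightarrow> ('a \<Rightarrow> complex) set) \<Rightarrow>
     ('a \<Rightarrow> complex) set set" where
  "orlicz_null M \<Phi> S = {F \<in> orlicz_space M \<Phi>. S F = ae_zero M}"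

section \<open>Conditional expectation and weighted conditional type operators\<close>

text \<open>
  \<^const>\<open>real_cond_exp\<close> is total; it is the conditional expectation of its argument only if that of the
  modulus is finite almost everywhere, which is recorded by \<open>cond_exp_defined\<close>.
\<close>

definition cond_exp_defined :: "'a measure \<Rightarrow> 'a measure \<Rightarrow> ('a \<Rightarrow> complex) \<Rightarrow> bool" where
  "cond_exp_defined M A f \<longleftrightarrow>
     f \<in> borel_measurable M \<and> (AE x in M. nn_cond_exp M A (\<lambda>y. ennreal (cmod (f y))) x < \<infinity>)"

definition complex_cond_exp :: "'a measure \<Rightarrow> 'a measure \<Rightarrow> ('a \<Rightarrow> complex) \<Rightarrow> 'a \<Rightarrow> complex" where
  "complex_cond_exp M A f x =
     Complex (real_cond_exp M A (\<lambda>y. Re (f y)) x) (real_cond_exp M A (\<lambda>y. Im (f y)) x)"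

definition wct ::
    "'a measure \<Rightarrow> 'a measure \<Rightarrow> ('a \<Rightarrow> complex) \<Rightarrow> ('a \<Rightarrow> complex) \<Rightarrow>
     ('a \<Rightarrow> complex) \<Rightarrow> 'a \<Rightarrow> complex" where
  "wct M A w u f = (\<lambda>x. w x * complex_cond_exp M A (\<lambda>y. u y * f y) x)"

definition wct_op ::
    "'a measure \<Rightarrow> 'a measure \<Rightarrow> ('a \<Rightarrow> complex) \<Rightarrow> ('a \<Rightarrow> complex) \<Rightarrow>
     ('a \<Rightarrow> complex) set \<Rightarrow> ('a \<Rightarrow> complex) set" where
  "wct_op M A w u F = (\<Union>f\<in>F. ae_class M (wct M A w u f))"

section \<open>Well-definedness\<close>

lemma ae_class_eqI:
  assumes "AE x in M. f x = g x"
  shows "ae_class M f = ae_class M g"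
proof -
  have "(AE x in M. h x = f x) \<longleftrightarrow> (AE x in M. h x = g x)" for h
    proof
    assume "AE x in M. h x = f x" then show "AE x in M. h x = g x" using assms by eventually_elim simp
  next
    assume "AE x in M. h x = g x" then show "AE x in M. h x = f x" using assms by eventually_elim simp
  qed
  then show ?thesis by (simp add: ae_class_def)
qed

lemma ae_class_self: "f \<in> borel_measurable M \<Longrightarrow> f \<in> ae_class M f"
  by (simp add: ae_class_def)

lemma ae_class_eq_iff:
  assumes "f \<in> borel_measurable M"
  shows "ae_class M f = ae_class M g \<longleftrightarrow> (AE x in M. f x = g x)"
proof
  assume "ae_class M f = ae_class M g"
  then have "f \<in> ae_class M g" using ae_class_self[OF assms] by simp
  then show "AE x in M. f x = g x" by (simp add: ae_class_def)
qed (rule ae_class_eqI)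

lemma UN_eq_class:
  assumes "f \<in> F" and "\<And>f'. f' \<in> F \<Longrightarrow> B f' = C"
  shows "(\<Union>f'\<in>F. B f') = C"
  using assms by auto

lemma ae_plus_ae_class:
  assumes "f \<in> borel_measurable M" "g \<in> borel_measurable M"
  shows "ae_plus M (ae_class M f) (ae_class M g) = ae_class M (\<lambda>x. f x + g x)"
proof -
  have "ae_class M (\<lambda>x. f' x + g' x) = ae_class M (\<lambda>x. f x + g x)"
    if "f' \<in> ae_class M f" "g' \<in> ae_class M g" for f' g'
  proof (rule ae_class_eqI)
    have "AE x in M. f' x = f x" "AE x in M. g' x = g x" using that by (auto simp: ae_class_def)
    then show "AE x in M. f' x + g' x = f x + g x" by eventually_elim simp
  qed
  then show ?thesis
    using assms[THEN ae_class_self] unfolding ae_plus_def by (intro UN_eq_class)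
qed

lemma ae_minus_ae_class:
  assumes "f \<in> borel_measurable M" "g \<in> borel_measurable M"
  shows "ae_minus M (ae_class M f) (ae_class M g) = ae_class M (\<lambda>x. f x - g x)"
proof -
  have "ae_class M (\<lambda>x. f' x - g' x) = ae_class M (\<lambda>x. f x - g x)"
    if "f' \<in> ae_class M f" "g' \<in> ae_class M g" for f' g'
  proof (rule ae_class_eqI)
    have "AE x in M. f' x = f x" "AE x in M. g' x = g x" using that by (auto simp: ae_class_def)
    then show "AE x in M. f' x - g' x = f x - g x" by eventually_elim simp
  qed
  then show ?thesis
    using assms[THEN ae_class_self] unfolding ae_minus_def by (intro UN_eq_class)
qed

lemma orlicz_modular_cong:
  assumes "AE x in M. f x = g x"
  shows "orlicz_modular M \<Phi> f = orlicz_modular M \<Phi> g"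
  unfolding orlicz_modular_def using assms by (intro nn_integral_cong_AE, eventually_elim) simp

lemma luxemburg_norm_cong:
  assumes "AE x in M. f x = g x"
  shows "luxemburg_norm M \<Phi> f = luxemburg_norm M \<Phi> g"
proof -
  have "orlicz_modular M \<Phi> (\<lambda>x. f x / complex_of_real k)
      = orlicz_modular M \<Phi> (\<lambda>x. g x / complex_of_real k)" for k
    using assms by (intro orlicz_modular_cong, eventually_elim) simp
  then show ?thesis by (simp add: luxemburg_norm_def)
qed

lemma orlicz_norm_ae_class:
  assumes "f \<in> borel_measurable M"
  shows "orlicz_norm M \<Phi> (ae_class M f) = luxemburg_norm M \<Phi> f"
proof -
  have "luxemburg_norm M \<Phi> g = luxemburg_norm M \<Phi> f" if "g \<in> ae_class M f" for g
    using that by (intro luxemburg_norm_cong) (simp add: ae_class_def)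
  then have "luxemburg_norm M \<Phi> ` ae_class M f = {luxemburg_norm M \<Phi> f}"
    using ae_class_self[OF assms] by blast
  then show ?thesis by (simp add: orlicz_norm_def)
qed

lemma orlicz_functions_borel: "f \<in> orlicz_functions M \<Phi> \<Longrightarrow> f \<in> borel_measurable M"
  by (simp add: orlicz_functions_def)

lemma ae_class_in_orlicz_space_iff:
  assumes "f \<in> borel_measurable M"
  shows "ae_class M f \<in> orlicz_space M \<Phi> \<longleftrightarrow> f \<in> orlicz_functions M \<Phi>"
proof
  assume "ae_class M f \<in> orlicz_space M \<Phi>"
  then obtain g where g: "g \<in> orlicz_functions M \<Phi>" "ae_class M f = ae_class M g"
    by (auto simp: orlicz_space_def)
  then have eq: "AE x in M. f x = g x" using ae_class_eq_iff[OF assms] by simp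
  obtain k where k: "k > 0" "orlicz_modular M \<Phi> (\<lambda>x. complex_of_real k * g x) < \<infinity>"
    using g(1) by (auto simp: orlicz_functions_def)
  have "orlicz_modular M \<Phi> (\<lambda>x. complex_of_real k * f x)
      = orlicz_modular M \<Phi> (\<lambda>x. complex_of_real k * g x)"
    using eq by (intro orlicz_modular_cong, eventually_elim) simp
  then show "f \<in> orlicz_functions M \<Phi>"
    using k assms by (auto simp: orlicz_functions_def)
qed (simp add: orlicz_space_def)

lemma complex_cond_exp_measurable [measurable]:
  shows "complex_cond_exp M A f \<in> borel_measurable A"
    and "complex_cond_exp M A f \<in> borel_measurable M"
  unfolding complex_cond_exp_def[abs_def] Complex_eq by measurable

lemma wct_op_ae_class:
  assumes "sigma_finite_subalgebra M A"
    and [measurable]: "u \<in> borel_measurable M" "f \<in> borel_measurable M"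
  shows "wct_op M A w u (ae_class M f) = ae_class M (wct M A w u f)"
proof -
  interpret sigma_finite_subalgebra M A by fact
  have "ae_class M (wct M A w u g) = ae_class M (wct M A w u f)" if g: "g \<in> ae_class M f" for g
  proof (rule ae_class_eqI)
    have [measurable]: "g \<in> borel_measurable M" and eq: "AE x in M. g x = f x"
      using g by (auto simp: ae_class_def)
    have "AE x in M. Re (u x * g x) = Re (u x * f x)" using eq by eventually_elim simp
    then have "AE x in M. real_cond_exp M A (\<lambda>y. Re (u y * g y)) x
                   = real_cond_exp M A (\<lambda>y. Re (u y * f y)) x"
      by (rule real_cond_exp_cong) measurable
    moreover have "AE x in M. Im (u x * g x) = Im (u x * f x)" using eq by eventually_elim simp
    then have "AE x in M. real_cond_exp M A (\<lambda>y. Im (u y * g y)) x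
                   = real_cond_exp M A (\<lambda>y. Im (u y * f y)) x"
      by (rule real_cond_exp_cong) measurable
    ultimately show "AE x in M. wct M A w u g x = wct M A w u f x"
      unfolding wct_def complex_cond_exp_def by eventually_elim simp
  qed
  then show ?thesis
    using ae_class_self[OF assms(3)] unfolding wct_op_def by (intro UN_eq_class)
qed

lemma young_function_convexD:
  assumes "young_function \<Phi>" "0 \<le> t" "t \<le> 1"
  shows "\<Phi> ((1 - t) * x + t * y) \<le> ennreal (1 - t) * \<Phi> x + ennreal t * \<Phi> y"
proof -
  have "t \<in> {0..1}" using assms by simp
  from bspec[OF spec[OF spec[OF conjunct1[OF assms(1)[unfolded young_function_def]]]] this]
  show ?thesis .
qed

lemma young_function_zero: "young_function \<Phi> \<Longrightarrow> \<Phi> 0 = 0"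
  unfolding young_function_def by (elim conjE)

lemma young_function_minus: "young_function \<Phi> \<Longrightarrow> \<Phi> (- x) = \<Phi> x"
  unfolding young_function_def by (elim conjE) (erule spec)

lemma young_function_nonzero: "young_function \<Phi> \<Longrightarrow> \<exists>c>0. \<Phi> c \<noteq> 0"
  unfolding young_function_def by (elim conjE)

lemma young_function_scale:
  assumes "young_function \<Phi>" "0 \<le> t" "t \<le> 1"
  shows "\<Phi> (t * x) \<le> ennreal t * \<Phi> x"
proof -
  have "\<Phi> ((1 - t) * 0 + t * x) \<le> ennreal (1 - t) * \<Phi> 0 + ennreal t * \<Phi> x"
    using assms by (rule young_function_convexD)
  then show ?thesis by (simp add: young_function_zero[OF assms(1)])
qed

lemma young_function_mono:
  assumes "young_function \<Phi>" "0 \<le> x" "x \<le> y"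
  shows "\<Phi> x \<le> \<Phi> y"
proof (cases "y = 0")
  case False
  then have y: "y > 0" using assms by simp
  have "\<Phi> (x / y * y) \<le> ennreal (x / y) * \<Phi> y"
    using assms y by (intro young_function_scale) auto
  also have "\<dots> \<le> 1 * \<Phi> y"
    using assms y by (intro mult_right_mono) (auto simp: ennreal_le_1)
  finally show ?thesis using y by simp
qed (use assms in auto)

lemma young_function_measurable:
  assumes "young_function \<Phi>"
  shows "\<Phi> \<in> borel_measurable borel"
proof -
  have "is_interval {x. y < \<Phi> (max 0 x)}" for y
    unfolding is_interval_1
  proof (intro ballI allI impI, elim conjE)
    fix a b x assume "a \<in> {x. y < \<Phi> (max 0 x)}" and "a \<le> x"
    then have "y < \<Phi> (max 0 a)" "\<Phi> (max 0 a) \<le> \<Phi> (max 0 x)"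
      using young_function_mono[OF assms, of "max 0 a" "max 0 x"] by simp_all
    then show "x \<in> {x. y < \<Phi> (max 0 x)}" by simp
  qed
  then have "(\<lambda>x. \<Phi> (max 0 x)) \<in> borel_measurable borel"
    by (intro borel_measurableI_greater) (simp add: real_interval_borel_measurable)
  then have "(\<lambda>x. \<Phi> (max 0 \<bar>x\<bar>)) \<in> borel_measurable borel"
    by (intro measurable_compose[where f = abs and g = "\<lambda>x. \<Phi> (max 0 x)" and N = borel]) simp_all
  moreover have "\<Phi> (max 0 \<bar>x\<bar>) = \<Phi> x" for x
  proof -
    show ?thesis using young_function_minus[OF assms, of x] by (cases "x \<ge> 0") simp_all
  qed
  ultimately show ?thesis by simp
qed

lemma orlicz_modular_convex:
  assumes \<Phi>: "young_function \<Phi>" and t: "0 \<le> t" "t \<le> 1"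
    and [measurable]: "f \<in> borel_measurable M" "g \<in> borel_measurable M"
  shows "orlicz_modular M \<Phi> (\<lambda>x. complex_of_real (1 - t) * f x + complex_of_real t * g x)
       \<le> ennreal (1 - t) * orlicz_modular M \<Phi> f + ennreal t * orlicz_modular M \<Phi> g"
proof -
  note [measurable] = young_function_measurable[OF \<Phi>]
  have "\<Phi> (cmod (complex_of_real (1 - t) * f x + complex_of_real t * g x))
      \<le> ennreal (1 - t) * \<Phi> (cmod (f x)) + ennreal t * \<Phi> (cmod (g x))" for x
  proof -
    have "cmod (complex_of_real (1 - t) * f x + complex_of_real t * g x)
        \<le> (1 - t) * cmod (f x) + t * cmod (g x)"
      using norm_triangle_ineq[of "complex_of_real (1 - t) * f x" "complex_of_real t * g x"] t
      by (simp add: norm_mult del: of_real_diff)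
    then have "\<Phi> (cmod (complex_of_real (1 - t) * f x + complex_of_real t * g x))
        \<le> \<Phi> ((1 - t) * cmod (f x) + t * cmod (g x))"
      by (intro young_function_mono[OF \<Phi>]) auto
    also have "\<dots> \<le> ennreal (1 - t) * \<Phi> (cmod (f x)) + ennreal t * \<Phi> (cmod (g x))"
      using \<Phi> t by (rule young_function_convexD)
    finally show ?thesis .
  qed
  then have "orlicz_modular M \<Phi> (\<lambda>x. complex_of_real (1 - t) * f x + complex_of_real t * g x)
      \<le> (\<integral>\<^sup>+x. ennreal (1 - t) * \<Phi> (cmod (f x)) + ennreal t * \<Phi> (cmod (g x)) \<partial>M)"
    unfolding orlicz_modular_def by (intro nn_integral_mono)
  also have "\<dots> = ennreal (1 - t) * orlicz_modular M \<Phi> f + ennreal t * orlicz_modular M \<Phi> g"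
    unfolding orlicz_modular_def by (simp add: nn_integral_add nn_integral_cmult)
  finally show ?thesis .
qed

lemma orlicz_modular_scale:
  assumes \<Phi>: "young_function \<Phi>" and t: "0 \<le> t" "t \<le> 1"
    and [measurable]: "f \<in> borel_measurable M"
  shows "orlicz_modular M \<Phi> (\<lambda>x. complex_of_real t * f x) \<le> ennreal t * orlicz_modular M \<Phi> f"
proof -
  have "orlicz_modular M \<Phi> (\<lambda>x. 0) = 0"
    by (simp add: orlicz_modular_def young_function_zero[OF \<Phi>])
  then show ?thesis
    using orlicz_modular_convex[OF \<Phi> t, of "\<lambda>x. 0" M f] by simp
qed

lemma orlicz_modular_mono_scale:
  assumes \<Phi>: "young_function \<Phi>" and "0 \<le> s" "s \<le> t"
  shows "orlicz_modular M \<Phi> (\<lambda>x. complex_of_real s * f x)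
       \<le> orlicz_modular M \<Phi> (\<lambda>x. complex_of_real t * f x)"
  unfolding orlicz_modular_def
  using assms by (intro nn_integral_mono young_function_mono) (auto simp: norm_mult intro!: mult_right_mono)

lemma orlicz_functions_minus:
  assumes \<Phi>: "young_function \<Phi>"
    and f: "f \<in> orlicz_functions M \<Phi>" and g: "g \<in> orlicz_functions M \<Phi>"
  shows "(\<lambda>x. f x - g x) \<in> orlicz_functions M \<Phi>"
proof -
  have [measurable]: "f \<in> borel_measurable M" "g \<in> borel_measurable M"
    using f g by (auto simp: orlicz_functions_def)
  obtain a b where a: "a > 0" "orlicz_modular M \<Phi> (\<lambda>x. complex_of_real a * f x) < \<infinity>"
    and b: "b > 0" "orlicz_modular M \<Phi> (\<lambda>x. complex_of_real b * g x) < \<infinity>"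
    using f g by (auto simp: orlicz_functions_def)
  define k where "k = min a b"
  have k: "k > 0" "k \<le> a" "k \<le> b" using a b by (auto simp: k_def)
  have fin: "orlicz_modular M \<Phi> (\<lambda>x. complex_of_real k * f x) < \<infinity>"
    "orlicz_modular M \<Phi> (\<lambda>x. complex_of_real k * g x) < \<infinity>"
    using orlicz_modular_mono_scale[OF \<Phi>, of k a M f] orlicz_modular_mono_scale[OF \<Phi>, of k b M g] k a b
    by (auto intro: le_less_trans)
  have neg: "orlicz_modular M \<Phi> (\<lambda>x. - (complex_of_real k * g x))
      = orlicz_modular M \<Phi> (\<lambda>x. complex_of_real k * g x)"
    by (simp add: orlicz_modular_def)
  have eq: "(\<lambda>x. complex_of_real (k/2) * (f x - g x))
      = (\<lambda>x. complex_of_real (1 - 1/2) * (complex_of_real k * f x)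
           + complex_of_real (1/2) * (- (complex_of_real k * g x)))"
    by (simp add: field_simps)
  have "orlicz_modular M \<Phi> (\<lambda>x. complex_of_real (k/2) * (f x - g x))
      \<le> ennreal (1 - 1/2) * orlicz_modular M \<Phi> (\<lambda>x. complex_of_real k * f x)
        + ennreal (1/2) * orlicz_modular M \<Phi> (\<lambda>x. - (complex_of_real k * g x))"
    unfolding eq by (rule orlicz_modular_convex[OF \<Phi>]) auto
  also have "\<dots> < \<infinity>"
    unfolding neg using fin by (auto simp: ennreal_mult_less_top simp del: ennreal_half)
  finally show ?thesis
    using k unfolding orlicz_functions_def by (auto intro!: exI[of _ "k/2"])
qed

lemma luxemburg_set_nonempty:
  assumes \<Phi>: "young_function \<Phi>" and f: "f \<in> orlicz_functions M \<Phi>"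
  shows "\<exists>k>0. orlicz_modular M \<Phi> (\<lambda>x. f x / complex_of_real k) \<le> 1"
proof -
  have [measurable]: "f \<in> borel_measurable M" using f by (rule orlicz_functions_borel)
  obtain a where a: "a > 0" "orlicz_modular M \<Phi> (\<lambda>x. complex_of_real a * f x) < \<infinity>"
    using f by (auto simp: orlicz_functions_def)
  then obtain r where r: "orlicz_modular M \<Phi> (\<lambda>x. complex_of_real a * f x) = ennreal r" "r \<ge> 0"
    by (cases "orlicz_modular M \<Phi> (\<lambda>x. complex_of_real a * f x)") auto
  define t where "t = 1 / (r + 1)"
  have t: "0 < t" "t \<le> 1" "t * r \<le> 1" using r by (auto simp: t_def field_simps)
  have "orlicz_modular M \<Phi> (\<lambda>x. complex_of_real t * (complex_of_real a * f x)) \<le> ennreal t * ennreal r"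
    unfolding r(1)[symmetric] using t by (intro orlicz_modular_scale[OF \<Phi>]) auto
  also have "\<dots> \<le> 1" using t r by (simp add: ennreal_mult[symmetric] ennreal_le_1)
  finally have "orlicz_modular M \<Phi> (\<lambda>x. f x / complex_of_real (1 / (t * a))) \<le> 1"
    by (simp add: mult_ac)
  then show ?thesis using t a by (intro exI[of _ "1 / (t * a)"]) auto
qed

lemma luxemburg_norm_le:
  assumes "k > 0" "orlicz_modular M \<Phi> (\<lambda>x. f x / complex_of_real k) \<le> 1"
  shows "luxemburg_norm M \<Phi> f \<le> k"
  unfolding luxemburg_norm_def using assms by (intro cInf_lower bdd_belowI[of _ 0]) auto

lemma luxemburg_norm_nonneg:
  assumes "young_function \<Phi>" "f \<in> orlicz_functions M \<Phi>"
  shows "0 \<le> luxemburg_norm M \<Phi> f"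
  unfolding luxemburg_norm_def using luxemburg_set_nonempty[OF assms] by (intro cInf_greatest) auto

lemma luxemburg_norm_less:
  assumes \<Phi>: "young_function \<Phi>" and f: "f \<in> orlicz_functions M \<Phi>" and a: "luxemburg_norm M \<Phi> f < a"
  shows "orlicz_modular M \<Phi> (\<lambda>x. f x / complex_of_real a) \<le> 1"
proof -
  obtain k where k: "k > 0" "orlicz_modular M \<Phi> (\<lambda>x. f x / complex_of_real k) \<le> 1" "k < a"
    using a luxemburg_set_nonempty[OF \<Phi> f] unfolding luxemburg_norm_def
    by (subst (asm) cInf_less_iff) (auto intro!: bdd_belowI[of _ 0])
  have "orlicz_modular M \<Phi> (\<lambda>x. f x / complex_of_real a)
      \<le> orlicz_modular M \<Phi> (\<lambda>x. f x / complex_of_real k)"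
    using orlicz_modular_mono_scale[OF \<Phi>, of "1 / a" "1 / k" M f] k by (simp add: frac_le)
  then show ?thesis using k by simp
qed

lemma luxemburg_norm_minus_commute:
  "luxemburg_norm M \<Phi> (\<lambda>x. f x - g x) = luxemburg_norm M \<Phi> (\<lambda>x. g x - f x)"
  by (simp add: luxemburg_norm_def orlicz_modular_def norm_divide norm_minus_commute)

lemma luxemburg_norm_triangle:
  assumes \<Phi>: "young_function \<Phi>"
    and f: "f \<in> orlicz_functions M \<Phi>" and g: "g \<in> orlicz_functions M \<Phi>"
  shows "luxemburg_norm M \<Phi> (\<lambda>x. f x + g x) \<le> luxemburg_norm M \<Phi> f + luxemburg_norm M \<Phi> g"
proof (rule field_le_epsilon)
  fix e :: real assume e: "e > 0"
  have [measurable]: "f \<in> borel_measurable M" "g \<in> borel_measurable M"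
    using f g by (auto dest: orlicz_functions_borel)
  define a where "a = luxemburg_norm M \<Phi> f + e / 2"
  define b where "b = luxemburg_norm M \<Phi> g + e / 2"
  have a: "a > 0" "orlicz_modular M \<Phi> (\<lambda>x. f x / complex_of_real a) \<le> 1"
    using luxemburg_norm_nonneg[OF \<Phi> f] e luxemburg_norm_less[OF \<Phi> f, of a] by (auto simp: a_def)
  have b: "b > 0" "orlicz_modular M \<Phi> (\<lambda>x. g x / complex_of_real b) \<le> 1"
    using luxemburg_norm_nonneg[OF \<Phi> g] e luxemburg_norm_less[OF \<Phi> g, of b] by (auto simp: b_def)
  define t where "t = b / (a + b)"
  have t: "0 \<le> t" "t \<le> 1" using a b by (auto simp: t_def)
  have ta: "1 - t = a / (a + b)" using a b by (simp add: t_def field_simps)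
  have eq: "(\<lambda>x. (f x + g x) / complex_of_real (a + b))
      = (\<lambda>x. complex_of_real (1 - t) * (f x / complex_of_real a)
           + complex_of_real t * (g x / complex_of_real b))"
    unfolding ta unfolding t_def using a b by (auto simp: add_divide_distrib)
  have "orlicz_modular M \<Phi> (\<lambda>x. (f x + g x) / complex_of_real (a + b))
      \<le> ennreal (1 - t) * orlicz_modular M \<Phi> (\<lambda>x. f x / complex_of_real a)
        + ennreal t * orlicz_modular M \<Phi> (\<lambda>x. g x / complex_of_real b)"
    unfolding eq by (rule orlicz_modular_convex[OF \<Phi> t]) auto
  also have "\<dots> \<le> ennreal (1 - t) * 1 + ennreal t * 1"
    using a b by (intro add_mono mult_left_mono) auto
  also have "\<dots> = 1" using t by (simp add: ennreal_plus[symmetric] del: ennreal_plus)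
  finally have "luxemburg_norm M \<Phi> (\<lambda>x. f x + g x) \<le> a + b"
    using a b by (intro luxemburg_norm_le) auto
  then show "luxemburg_norm M \<Phi> (\<lambda>x. f x + g x)
      \<le> luxemburg_norm M \<Phi> f + luxemburg_norm M \<Phi> g + e"
    by (simp add: a_def b_def)
qed

lemma luxemburg_norm_zero:
  assumes "young_function \<Phi>"
  shows "luxemburg_norm M \<Phi> (\<lambda>x. 0) = 0"
proof -
  have "orlicz_modular M \<Phi> (\<lambda>x. 0 / complex_of_real k) \<le> 1" for k
    by (simp add: orlicz_modular_def young_function_zero[OF assms])
  then have "{k. k > 0 \<and> orlicz_modular M \<Phi> (\<lambda>x. 0 / complex_of_real k) \<le> 1} = {0<..}"
    by auto
  then show ?thesis unfolding luxemburg_norm_def by (simp only: cInf_greaterThan)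
qed

lemma luxemburg_norm_eq_zeroD:
  assumes \<Phi>: "young_function \<Phi>" and f: "f \<in> orlicz_functions M \<Phi>"
    and zero: "luxemburg_norm M \<Phi> f = 0"
  shows "AE x in M. f x = 0"
proof -
  have [measurable]: "f \<in> borel_measurable M" using f by (rule orlicz_functions_borel)
  obtain c where c: "c > 0" "\<Phi> c \<noteq> 0" using young_function_nonzero[OF \<Phi>] by blast
  have bound: "emeasure M {x \<in> space M. cmod (f x) \<ge> e} * \<Phi> c \<le> ennreal (1 / real n)"
    if e: "e > 0" and n: "n > 0" for e n
  proof -
    let ?S = "{x \<in> space M. cmod (f x) \<ge> e}"
    define a where "a = e / (c * real n)"
    have a: "a > 0" using e n c by (simp add: a_def)
    have "ennreal (real n) * (emeasure M ?S * \<Phi> c) = (\<integral>\<^sup>+x. ennreal (real n) * \<Phi> c * indicator ?S x \<partial>M)"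
      by (subst nn_integral_cmult_indicator) (auto simp: mult_ac)
    also have "\<dots> \<le> (\<integral>\<^sup>+x. \<Phi> (cmod (f x / complex_of_real a)) \<partial>M)"
    proof (rule nn_integral_mono)
      fix x
      show "ennreal (real n) * \<Phi> c * indicator ?S x \<le> \<Phi> (cmod (f x / complex_of_real a))"
      proof (cases "x \<in> ?S")
        case True
        have "\<Phi> c = \<Phi> (1 / real n * (real n * c))" using n by simp
        also have "\<dots> \<le> ennreal (1 / real n) * \<Phi> (real n * c)"
          using n by (intro young_function_scale[OF \<Phi>]) auto
        finally have "ennreal (real n) * \<Phi> c \<le> ennreal (real n) * (ennreal (1 / real n) * \<Phi> (real n * c))"
          by (rule mult_left_mono) simp
        also have "\<dots> = \<Phi> (real n * c)"
          using n by (simp add: mult.assoc[symmetric] ennreal_mult[symmetric])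
        also have "\<dots> \<le> \<Phi> (cmod (f x / complex_of_real a))"
        proof (rule young_function_mono[OF \<Phi>])
          have "real n * c = e / a" using e c n by (simp add: a_def)
          also have "\<dots> \<le> cmod (f x) / a" using True a by (intro divide_right_mono) auto
          finally show "real n * c \<le> cmod (f x / complex_of_real a)" using a by (simp add: norm_divide)
        qed (use n c in auto)
        finally show ?thesis using True by simp
      qed simp
    qed
    also have "\<dots> \<le> 1"
      using luxemburg_norm_less[OF \<Phi> f, of a] zero a by (simp add: orlicz_modular_def)
    finally have "ennreal (1 / real n) * (ennreal (real n) * (emeasure M ?S * \<Phi> c)) \<le> ennreal (1 / real n) * 1"
      by (intro mult_left_mono) auto
    moreover have "ennreal (1 / real n) * (ennreal (real n) * z) = z" for z
      using n by (simp add: mult.assoc[symmetric] ennreal_mult[symmetric])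
    ultimately show ?thesis by simp
  qed
  have null: "emeasure M {x \<in> space M. cmod (f x) \<ge> e} = 0" if e: "e > 0" for e
  proof -
    let ?z = "emeasure M {x \<in> space M. cmod (f x) \<ge> e} * \<Phi> c"
    have "(\<lambda>n. ennreal (1 / real (Suc n))) \<longlonglongrightarrow> ennreal 0"
      by (intro tendsto_ennrealI LIMSEQ_Suc lim_1_over_n)
    then have "?z \<le> ennreal 0"
      by (rule LIMSEQ_le_const) (use bound[OF e zero_less_Suc] in blast)
    then show ?thesis using c by simp
  qed
  have "AE x in M. \<forall>n. \<not> cmod (f x) \<ge> 1 / real (Suc n)"
    unfolding AE_all_countable
    by (intro allI AE_I[OF _ null]) (auto intro!: divide_pos_pos)
  then show ?thesis
  proof eventually_elim
    case (elim x)
    show "f x = 0"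
    proof (rule ccontr)
      assume "f x \<noteq> 0"
      then obtain n where "1 / real (Suc n) < cmod (f x)"
        using reals_Archimedean[of "cmod (f x)"] by (auto simp: inverse_eq_divide)
      then show False using elim by (meson less_imp_le)
    qed
  qed
qed

lemma orlicz_dist_ae_class:
  assumes "f \<in> orlicz_functions M \<Phi>" "g \<in> orlicz_functions M \<Phi>"
  shows "orlicz_dist M \<Phi> (ae_class M f) (ae_class M g) = luxemburg_norm M \<Phi> (\<lambda>x. f x - g x)"
proof -
  have [measurable]: "f \<in> borel_measurable M" "g \<in> borel_measurable M"
    using assms by (auto dest: orlicz_functions_borel)
  show ?thesis
    using assms by (simp add: orlicz_dist_def orlicz_space_def ae_minus_ae_class orlicz_norm_ae_class)
qed

lemma Metric_space_orlicz:
  assumes \<Phi>: "young_function \<Phi>"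
  shows "Metric_space (orlicz_space M \<Phi>) (orlicz_dist M \<Phi>)"
proof (rule Metric_space.intro)
  have outside: "orlicz_dist M \<Phi> F G = 0" if "\<not> (F \<in> orlicz_space M \<Phi> \<and> G \<in> orlicz_space M \<Phi>)" for F G
    using that unfolding orlicz_dist_def by (rule if_not_P)
  fix F G H
  show "0 \<le> orlicz_dist M \<Phi> F G"
  proof (cases "F \<in> orlicz_space M \<Phi> \<and> G \<in> orlicz_space M \<Phi>")
    case True
    then obtain f g where "f \<in> orlicz_functions M \<Phi>" "F = ae_class M f"
      and "g \<in> orlicz_functions M \<Phi>" "G = ae_class M g"
      unfolding orlicz_space_def by blast
    then show ?thesis
      by (simp add: orlicz_dist_ae_class luxemburg_norm_nonneg[OF \<Phi>] orlicz_functions_minus[OF \<Phi>])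
  next
    case False
    from outside[OF this] show ?thesis by simp
  qed
  show "orlicz_dist M \<Phi> F G = orlicz_dist M \<Phi> G F"
  proof (cases "F \<in> orlicz_space M \<Phi> \<and> G \<in> orlicz_space M \<Phi>")
    case True
    then obtain f g where "f \<in> orlicz_functions M \<Phi>" "F = ae_class M f"
      and "g \<in> orlicz_functions M \<Phi>" "G = ae_class M g"
      unfolding orlicz_space_def by blast
    then show ?thesis
      using luxemburg_norm_minus_commute[of M \<Phi> f g] by (simp add: orlicz_dist_ae_class)
  next
    case False
    then have "\<not> (G \<in> orlicz_space M \<Phi> \<and> F \<in> orlicz_space M \<Phi>)" by blast
    from outside[OF this] outside[OF False] show ?thesis by simp
  qed
  assume "F \<in> orlicz_space M \<Phi>" "G \<in> orlicz_space M \<Phi>"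
  then obtain f g where f: "f \<in> orlicz_functions M \<Phi>" "F = ae_class M f"
    and g: "g \<in> orlicz_functions M \<Phi>" "G = ae_class M g"
    unfolding orlicz_space_def by blast
  show "orlicz_dist M \<Phi> F G = 0 \<longleftrightarrow> F = G"
  proof
    assume "orlicz_dist M \<Phi> F G = 0"
    then have "AE x in M. f x - g x = 0"
      using f g by (intro luxemburg_norm_eq_zeroD[OF \<Phi>] orlicz_functions_minus[OF \<Phi>])
        (auto simp: orlicz_dist_ae_class)
    then show "F = G" unfolding f g by (intro ae_class_eqI) simp
  next
    assume "F = G"
    then show "orlicz_dist M \<Phi> F G = 0"
      using orlicz_dist_ae_class[OF f(1) f(1)] luxemburg_norm_zero[OF \<Phi>, of M] f(2) by simp
  qed
  assume "H \<in> orlicz_space M \<Phi>"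
  then obtain h where h: "h \<in> orlicz_functions M \<Phi>" "H = ae_class M h"
    unfolding orlicz_space_def by blast
  have "luxemburg_norm M \<Phi> (\<lambda>x. f x - h x)
      \<le> luxemburg_norm M \<Phi> (\<lambda>x. f x - g x) + luxemburg_norm M \<Phi> (\<lambda>x. g x - h x)"
    using luxemburg_norm_triangle[OF \<Phi> orlicz_functions_minus[OF \<Phi> f(1) g(1)]
        orlicz_functions_minus[OF \<Phi> g(1) h(1)]] by simp
  then show "orlicz_dist M \<Phi> F H \<le> orlicz_dist M \<Phi> F G + orlicz_dist M \<Phi> G H"
    using f g h by (simp add: orlicz_dist_ae_class)
qed

end

theory Submission
  imports Defs
begin

text \<open>
  Write \<open>E\<close> for the conditional expectation, \<open>T f = w E(u f)\<close> and \<open>h = E(u w)\<close>. Functions measurable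
  with respect to the subalgebra can be pulled out of \<open>E\<close>. Hence \<open>T\<close> commutes with multiplication by
  such functions, and since \<open>E(u f)\<close> is one of them, \<open>T (T f) = h T f\<close>. So the range of \<open>T\<^sup>2\<close>
  consists of the classes of the functions \<open>h T f\<close>, and its null space of the classes of those \<open>f\<close>
  with \<open>h T f = 0\<close>.

  If \<open>h T f\<close> lies in the null space, then \<open>h\<^sup>3 T f = 0\<close>, which pointwise forces \<open>h T f = 0\<close>: the
  intersection is trivial (\<open>range_inter_null\<close>).

  The formal projection onto the range along the null space is \<open>f \<mapsto> T f / h\<close> on \<open>{h \<noteq> 0}\<close>, extended
  by zero, and the only obstacle to using it is that \<open>1 / h\<close> may be unbounded. Closedness of the range
  removes this obstacle: there is \<open>\<delta> > 0\<close> such that every \<open>T f\<close> vanishes a.e. on \<open>{0 < \<bar>h\<bar> < \<delta>}\<close>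
  (\<open>wct_vanishes_near_zeros_of_h\<close>). Granted this, \<open>1 / h\<close> may be cut off where \<open>\<bar>h\<bar> < \<delta>\<close> without
  changing the projection, and every \<open>f\<close> splits, so that the sum of range and null space is not only
  dense but the whole space (\<open>range_plus_null\<close>).

  The bound \<open>\<delta>\<close> comes from a gliding hump argument. If it did not exist, then on infinitely many of
  the disjoint shells \<open>4\<^bsup>-k-1\<^esup> \<le> \<bar>h\<bar> < 4\<^bsup>-k\<^esup>\<close> there would be some \<open>T f\<^sub>k\<close> of size about one. The series of
  the functions \<open>2\<^bsup>k\<^esup> h T f\<^sub>k\<close> cut to the shells converges, because \<open>h\<close> beats \<open>2\<^bsup>k\<^esup>\<close>
  (\<open>luxemburg_disjoint_series\<close>), and its partial sums lie in the range. By closedness its sum is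
  \<open>h T p\<close> for some \<open>p\<close>, and dividing by \<open>h\<close> gives \<open>T p = 2\<^bsup>k\<^esup> T f\<^sub>k\<close> on the \<open>k\<close>-th shell for all these
  \<open>k\<close>, which is too large for a function of the Orlicz space.
\<close>

section \<open>Conditional expectation of functions with finite conditional modulus\<close>

context sigma_finite_subalgebra
begin

text \<open>
  The functions \<open>u f\<close> need not be integrable; only the conditional expectation of their modulus is
  finite. This is enough to compute \<^const>\<open>real_cond_exp\<close> from any decomposition into nonnegative
  parts, not only from the positive and negative part, so that additivity and the pull-out property
  reduce to those of \<^const>\<open>nn_cond_exp\<close>.
\<close>

lemma real_cond_exp_diff_of_nonneg:
  fixes p q :: "'a \<Rightarrow> real"
  assumes [measurable]: "p \<in> borel_measurable M" "q \<in> borel_measurable M"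
    and nonneg: "\<And>x. 0 \<le> p x" "\<And>x. 0 \<le> q x"
    and fin: "AE x in M. nn_cond_exp M F (\<lambda>x. ennreal (p x)) x < \<infinity>"
      "AE x in M. nn_cond_exp M F (\<lambda>x. ennreal (q x)) x < \<infinity>"
  shows "AE x in M. real_cond_exp M F (\<lambda>x. p x - q x) x
           = enn2real (nn_cond_exp M F (\<lambda>x. ennreal (p x)) x)
             - enn2real (nn_cond_exp M F (\<lambda>x. ennreal (q x)) x)"
proof -
  let ?E = "nn_cond_exp M F"
  have eq: "(\<lambda>x. ennreal (p x - q x) + ennreal (q x)) = (\<lambda>x. ennreal (- (p x - q x)) + ennreal (p x))"
  proof
    fix x
    show "ennreal (p x - q x) + ennreal (q x) = ennreal (- (p x - q x)) + ennreal (p x)"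
      using nonneg[of x] by (cases "p x \<ge> q x") (simp_all add: ennreal_neg ennreal_plus[symmetric] del: ennreal_plus)
  qed
  have "AE x in M. ?E (\<lambda>x. ennreal (p x - q x)) x + ?E (\<lambda>x. ennreal (q x)) x
      = ?E (\<lambda>x. ennreal (p x - q x) + ennreal (q x)) x"
    by (rule nn_cond_exp_sum) measurable
  moreover have "AE x in M. ?E (\<lambda>x. ennreal (- (p x - q x))) x + ?E (\<lambda>x. ennreal (p x)) x
      = ?E (\<lambda>x. ennreal (- (p x - q x)) + ennreal (p x)) x"
    by (rule nn_cond_exp_sum) measurable
  moreover have "AE x in M. ?E (\<lambda>x. ennreal (p x - q x)) x \<le> ?E (\<lambda>x. ennreal (p x)) x"
    using nonneg by (intro nn_cond_exp_mono) (auto intro!: ennreal_leI)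
  moreover have "AE x in M. ?E (\<lambda>x. ennreal (- (p x - q x))) x \<le> ?E (\<lambda>x. ennreal (q x)) x"
    using nonneg by (intro nn_cond_exp_mono) (auto intro!: ennreal_leI)
  ultimately show ?thesis
    using fin
  proof eventually_elim
    case (elim x)
    define a b c d where abcd: "a = ?E (\<lambda>x. ennreal (p x - q x)) x" "b = ?E (\<lambda>x. ennreal (- (p x - q x))) x"
      "c = ?E (\<lambda>x. ennreal (p x)) x" "d = ?E (\<lambda>x. ennreal (q x)) x"
    have "a + d = b + c"
      using elim(1,2) unfolding abcd eq by simp
    moreover have "c < \<infinity>" "d < \<infinity>" "a < \<infinity>" "b < \<infinity>"
      using elim(5,6) le_less_trans[OF elim(3,5)] le_less_trans[OF elim(4,6)] unfolding abcd by auto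
    ultimately have "enn2real a + enn2real d = enn2real b + enn2real c"
      using enn2real_plus[of a d] enn2real_plus[of b c] by simp
    then show ?case
      unfolding real_cond_exp_def abcd by simp
  qed
qed

lemma nn_cond_exp_finite_mono:
  assumes "AE x in M. nn_cond_exp M F g x < \<infinity>" "AE x in M. f x \<le> g x"
    and [measurable]: "f \<in> borel_measurable M" "g \<in> borel_measurable M"
  shows "AE x in M. nn_cond_exp M F f x < \<infinity>"
proof -
  have "AE x in M. nn_cond_exp M F f x \<le> nn_cond_exp M F g x"
    by (rule nn_cond_exp_mono[OF assms(2)]) measurable
  with assms(1) show ?thesis by eventually_elim (rule le_less_trans)
qed

lemma nn_cond_exp_parts_finite:
  assumes [measurable]: "f \<in> borel_measurable M"
    and "AE x in M. nn_cond_exp M F (\<lambda>x. ennreal \<bar>f x\<bar>) x < \<infinity>"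
  shows "AE x in M. nn_cond_exp M F (\<lambda>x. ennreal (f x)) x < \<infinity>"
    and "AE x in M. nn_cond_exp M F (\<lambda>x. ennreal (- f x)) x < \<infinity>"
  by (rule nn_cond_exp_finite_mono[OF assms(2)]; auto intro!: ennreal_leI AE_I2)+

lemma real_cond_exp_add_of_finite:
  assumes [measurable]: "f \<in> borel_measurable M" "g \<in> borel_measurable M"
    and f: "AE x in M. nn_cond_exp M F (\<lambda>x. ennreal \<bar>f x\<bar>) x < \<infinity>"
    and g: "AE x in M. nn_cond_exp M F (\<lambda>x. ennreal \<bar>g x\<bar>) x < \<infinity>"
  shows "AE x in M. real_cond_exp M F (\<lambda>x. f x + g x) x = real_cond_exp M F f x + real_cond_exp M F g x"
proof -
  let ?E = "nn_cond_exp M F"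
  define p q where "p = (\<lambda>x. max (f x) 0 + max (g x) 0)" and "q = (\<lambda>x. max (- f x) 0 + max (- g x) 0)"
  have [measurable]: "p \<in> borel_measurable M" "q \<in> borel_measurable M"
    unfolding p_def q_def by measurable
  have split: "(\<lambda>x. ennreal (p x)) = (\<lambda>x. ennreal (f x) + ennreal (g x))"
    "(\<lambda>x. ennreal (q x)) = (\<lambda>x. ennreal (- f x) + ennreal (- g x))"
    by (auto simp: p_def q_def ennreal_plus max_def ennreal_neg)
  note fin = nn_cond_exp_parts_finite[OF assms(1) f] nn_cond_exp_parts_finite[OF assms(2) g]
  have P: "AE x in M. ?E (\<lambda>x. ennreal (f x)) x + ?E (\<lambda>x. ennreal (g x)) x = ?E (\<lambda>x. ennreal (p x)) x"
    unfolding split by (rule nn_cond_exp_sum) measurable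
  have Q: "AE x in M. ?E (\<lambda>x. ennreal (- f x)) x + ?E (\<lambda>x. ennreal (- g x)) x = ?E (\<lambda>x. ennreal (q x)) x"
    unfolding split by (rule nn_cond_exp_sum) measurable
  have "AE x in M. ?E (\<lambda>x. ennreal (p x)) x < \<infinity>"
    using P fin(1,3)
  proof eventually_elim
    case (elim x)
    then show ?case unfolding elim(1)[symmetric] by simp
  qed
  moreover have "AE x in M. ?E (\<lambda>x. ennreal (q x)) x < \<infinity>"
    using Q fin(2,4)
  proof eventually_elim
    case (elim x)
    then show ?case unfolding elim(1)[symmetric] by simp
  qed
  ultimately have D: "AE x in M. real_cond_exp M F (\<lambda>x. p x - q x) x
           = enn2real (?E (\<lambda>x. ennreal (p x)) x) - enn2real (?E (\<lambda>x. ennreal (q x)) x)"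
    by (intro real_cond_exp_diff_of_nonneg) (auto simp: p_def q_def)
  have eq: "(\<lambda>x. p x - q x) = (\<lambda>x. f x + g x)"
    by (auto simp: p_def q_def max_def)
  show ?thesis
    using D P Q fin
  proof eventually_elim
    case (elim x)
    then show ?case
      unfolding eq elim(2,3)[symmetric]
      by (simp add: real_cond_exp_def enn2real_plus)
  qed
qed

lemma real_cond_exp_mult_of_finite:
  assumes \<phi> [measurable]: "\<phi> \<in> borel_measurable F" and [measurable]: "f \<in> borel_measurable M"
    and f: "AE x in M. nn_cond_exp M F (\<lambda>x. ennreal \<bar>f x\<bar>) x < \<infinity>"
  shows "AE x in M. real_cond_exp M F (\<lambda>x. \<phi> x * f x) x = \<phi> x * real_cond_exp M F f x"
proof -
  let ?E = "nn_cond_exp M F"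
  have [measurable]: "\<phi> \<in> borel_measurable M"
    using measurable_from_subalg[OF subalg \<phi>] .
  define p q where "p = (\<lambda>x. max (\<phi> x) 0 * max (f x) 0 + max (- \<phi> x) 0 * max (- f x) 0)"
    and "q = (\<lambda>x. max (\<phi> x) 0 * max (- f x) 0 + max (- \<phi> x) 0 * max (f x) 0)"
  have [measurable]: "p \<in> borel_measurable M" "q \<in> borel_measurable M"
    unfolding p_def q_def by measurable
  have pos: "ennreal (max a 0) = ennreal a" for a
    by (simp add: max_def ennreal_neg)
  have split: "(\<lambda>x. ennreal (p x)) = (\<lambda>x. ennreal (\<phi> x) * ennreal (f x) + ennreal (- \<phi> x) * ennreal (- f x))"
    "(\<lambda>x. ennreal (q x)) = (\<lambda>x. ennreal (\<phi> x) * ennreal (- f x) + ennreal (- \<phi> x) * ennreal (f x))"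
    by (simp_all add: p_def q_def ennreal_mult pos)
  have expand: "AE x in M. ennreal (\<phi> x) * ?E a x + ennreal (- \<phi> x) * ?E b x
      = ?E (\<lambda>x. ennreal (\<phi> x) * a x + ennreal (- \<phi> x) * b x) x"
    if [measurable]: "a \<in> borel_measurable M" "b \<in> borel_measurable M" for a b
  proof -
    have "AE x in M. ennreal (\<phi> x) * ?E a x = ?E (\<lambda>x. ennreal (\<phi> x) * a x) x"
      by (rule nn_cond_exp_prod) measurable
    moreover have "AE x in M. ennreal (- \<phi> x) * ?E b x = ?E (\<lambda>x. ennreal (- \<phi> x) * b x) x"
      by (rule nn_cond_exp_prod) measurable
    moreover have "AE x in M. ?E (\<lambda>x. ennreal (\<phi> x) * a x) x + ?E (\<lambda>x. ennreal (- \<phi> x) * b x) x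
        = ?E (\<lambda>x. ennreal (\<phi> x) * a x + ennreal (- \<phi> x) * b x) x"
      by (rule nn_cond_exp_sum) measurable
    ultimately show ?thesis by eventually_elim simp
  qed
  note fin = nn_cond_exp_parts_finite[OF \<open>f \<in> borel_measurable M\<close> f]
  have P: "AE x in M. ennreal (\<phi> x) * ?E (\<lambda>x. ennreal (f x)) x + ennreal (- \<phi> x) * ?E (\<lambda>x. ennreal (- f x)) x
      = ?E (\<lambda>x. ennreal (p x)) x"
    unfolding split by (rule expand) measurable
  have Q: "AE x in M. ennreal (\<phi> x) * ?E (\<lambda>x. ennreal (- f x)) x + ennreal (- \<phi> x) * ?E (\<lambda>x. ennreal (f x)) x
      = ?E (\<lambda>x. ennreal (q x)) x"
    unfolding split by (rule expand) measurable
  have "AE x in M. ?E (\<lambda>x. ennreal (p x)) x < \<infinity>"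
    using P fin
  proof eventually_elim
    case (elim x)
    then show ?case unfolding elim(1)[symmetric] by (simp add: ennreal_mult_less_top)
  qed
  moreover have "AE x in M. ?E (\<lambda>x. ennreal (q x)) x < \<infinity>"
    using Q fin
  proof eventually_elim
    case (elim x)
    then show ?case unfolding elim(1)[symmetric] by (simp add: ennreal_mult_less_top)
  qed
  ultimately have D: "AE x in M. real_cond_exp M F (\<lambda>x. p x - q x) x
           = enn2real (?E (\<lambda>x. ennreal (p x)) x) - enn2real (?E (\<lambda>x. ennreal (q x)) x)"
    by (intro real_cond_exp_diff_of_nonneg) (auto simp: p_def q_def)
  have eq: "(\<lambda>x. p x - q x) = (\<lambda>x. \<phi> x * f x)"
    by (auto simp: p_def q_def max_def)
  show ?thesis
    using D P Q
  proof eventually_elim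
    case (elim x)
    then show ?case
      unfolding eq elim(2,3)[symmetric]
      by (cases "\<phi> x \<ge> 0") (simp_all add: real_cond_exp_def ennreal_neg enn2real_mult algebra_simps)
  qed
qed

lemma cond_exp_defined_Re_Im_finite:
  assumes "cond_exp_defined M F f"
  shows "AE x in M. nn_cond_exp M F (\<lambda>x. ennreal \<bar>Re (f x)\<bar>) x < \<infinity>"
    and "AE x in M. nn_cond_exp M F (\<lambda>x. ennreal \<bar>Im (f x)\<bar>) x < \<infinity>"
proof -
  have [measurable]: "f \<in> borel_measurable M"
    and fin: "AE x in M. nn_cond_exp M F (\<lambda>x. ennreal (cmod (f x))) x < \<infinity>"
    using assms by (auto simp: cond_exp_defined_def)
  show "AE x in M. nn_cond_exp M F (\<lambda>x. ennreal \<bar>Re (f x)\<bar>) x < \<infinity>"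
    by (rule nn_cond_exp_finite_mono[OF fin]) (auto intro!: ennreal_leI abs_Re_le_cmod)
  show "AE x in M. nn_cond_exp M F (\<lambda>x. ennreal \<bar>Im (f x)\<bar>) x < \<infinity>"
    by (rule nn_cond_exp_finite_mono[OF fin]) (auto intro!: ennreal_leI abs_Im_le_cmod)
qed

lemma complex_cond_exp_add:
  assumes f: "cond_exp_defined M F f" and g: "cond_exp_defined M F g"
  shows "AE x in M. complex_cond_exp M F (\<lambda>x. f x + g x) x
           = complex_cond_exp M F f x + complex_cond_exp M F g x"
proof -
  have [measurable]: "f \<in> borel_measurable M" "g \<in> borel_measurable M"
    using f g by (auto simp: cond_exp_defined_def)
  note fin = cond_exp_defined_Re_Im_finite[OF f] cond_exp_defined_Re_Im_finite[OF g]
  have "AE x in M. real_cond_exp M F (\<lambda>x. Re (f x) + Re (g x)) x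
      = real_cond_exp M F (\<lambda>x. Re (f x)) x + real_cond_exp M F (\<lambda>x. Re (g x)) x"
    by (rule real_cond_exp_add_of_finite[OF _ _ fin(1,3)]) measurable
  moreover have "AE x in M. real_cond_exp M F (\<lambda>x. Im (f x) + Im (g x)) x
      = real_cond_exp M F (\<lambda>x. Im (f x)) x + real_cond_exp M F (\<lambda>x. Im (g x)) x"
    by (rule real_cond_exp_add_of_finite[OF _ _ fin(2,4)]) measurable
  ultimately show ?thesis
    by eventually_elim (simp add: complex_cond_exp_def complex_eq_iff)
qed

lemma complex_cond_exp_mult:
  assumes \<phi> [measurable]: "\<phi> \<in> borel_measurable F" and f: "cond_exp_defined M F f"
  shows "AE x in M. complex_cond_exp M F (\<lambda>x. \<phi> x * f x) x = \<phi> x * complex_cond_exp M F f x"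
proof -
  have [measurable]: "f \<in> borel_measurable M" "\<phi> \<in> borel_measurable M"
    using f measurable_from_subalg[OF subalg \<phi>] by (auto simp: cond_exp_defined_def)
  have pull: "AE x in M. real_cond_exp M F (\<lambda>x. a x * r x + b x * s x) x
      = a x * real_cond_exp M F r x + b x * real_cond_exp M F s x"
    if [measurable]: "a \<in> borel_measurable F" "b \<in> borel_measurable F"
        "r \<in> borel_measurable M" "s \<in> borel_measurable M"
      and fin: "AE x in M. nn_cond_exp M F (\<lambda>x. ennreal \<bar>r x\<bar>) x < \<infinity>"
        "AE x in M. nn_cond_exp M F (\<lambda>x. ennreal \<bar>s x\<bar>) x < \<infinity>"
    for a b r s :: "'a \<Rightarrow> real"
  proof -
    have [measurable]: "a \<in> borel_measurable M" "b \<in> borel_measurable M"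
      using measurable_from_subalg[OF subalg that(1)] measurable_from_subalg[OF subalg that(2)] by auto
    have mult_fin: "AE x in M. nn_cond_exp M F (\<lambda>x. ennreal \<bar>c x * t x\<bar>) x < \<infinity>"
      if [measurable]: "c \<in> borel_measurable F" "t \<in> borel_measurable M"
        and "AE x in M. nn_cond_exp M F (\<lambda>x. ennreal \<bar>t x\<bar>) x < \<infinity>" for c t :: "'a \<Rightarrow> real"
    proof -
      have "AE x in M. ennreal \<bar>c x\<bar> * nn_cond_exp M F (\<lambda>x. ennreal \<bar>t x\<bar>) x
          = nn_cond_exp M F (\<lambda>x. ennreal \<bar>c x\<bar> * ennreal \<bar>t x\<bar>) x"
        by (rule nn_cond_exp_prod) measurable
      with that(3) show ?thesis
        by eventually_elim (simp add: abs_mult ennreal_mult, metis ennreal_mult_less_top ennreal_less_top)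
    qed
    have "AE x in M. real_cond_exp M F (\<lambda>x. a x * r x + b x * s x) x
        = real_cond_exp M F (\<lambda>x. a x * r x) x + real_cond_exp M F (\<lambda>x. b x * s x) x"
      using fin by (intro real_cond_exp_add_of_finite mult_fin) auto
    moreover have "AE x in M. real_cond_exp M F (\<lambda>x. a x * r x) x = a x * real_cond_exp M F r x"
      using fin by (intro real_cond_exp_mult_of_finite) auto
    moreover have "AE x in M. real_cond_exp M F (\<lambda>x. b x * s x) x = b x * real_cond_exp M F s x"
      using fin by (intro real_cond_exp_mult_of_finite) auto
    ultimately show ?thesis by eventually_elim simp
  qed
  note fin = cond_exp_defined_Re_Im_finite[OF f]
  have "AE x in M. real_cond_exp M F (\<lambda>x. Re (\<phi> x) * Re (f x) + - Im (\<phi> x) * Im (f x)) x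
      = Re (\<phi> x) * real_cond_exp M F (\<lambda>x. Re (f x)) x + - Im (\<phi> x) * real_cond_exp M F (\<lambda>x. Im (f x)) x"
    using fin by (intro pull) auto
  moreover have "AE x in M. real_cond_exp M F (\<lambda>x. Re (\<phi> x) * Im (f x) + Im (\<phi> x) * Re (f x)) x
      = Re (\<phi> x) * real_cond_exp M F (\<lambda>x. Im (f x)) x + Im (\<phi> x) * real_cond_exp M F (\<lambda>x. Re (f x)) x"
    using fin by (intro pull) auto
  ultimately show ?thesis
    by eventually_elim (simp add: complex_cond_exp_def complex_eq_iff)
qed

end

section \<open>Orlicz functions\<close>

lemma orlicz_modular_mono:
  assumes \<Phi>: "young_function \<Phi>" and "AE x in M. cmod (f x) \<le> cmod (g x)"
  shows "orlicz_modular M \<Phi> f \<le> orlicz_modular M \<Phi> g"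
  unfolding orlicz_modular_def
proof (rule nn_integral_mono_AE)
  show "AE x in M. \<Phi> (cmod (f x)) \<le> \<Phi> (cmod (g x))"
    using assms(2) by eventually_elim (auto intro: young_function_mono[OF \<Phi>])
qed

lemma zero_in_orlicz_functions: "young_function \<Phi> \<Longrightarrow> (\<lambda>x. 0) \<in> orlicz_functions M \<Phi>"
  by (auto simp: orlicz_functions_def orlicz_modular_def young_function_zero intro!: exI[of _ 1])

lemma orlicz_functions_solid:
  assumes \<Phi>: "young_function \<Phi>" and f: "f \<in> orlicz_functions M \<Phi>"
    and g: "g \<in> borel_measurable M" and le: "AE x in M. cmod (g x) \<le> c * cmod (f x)"
  shows "g \<in> orlicz_functions M \<Phi>"
proof -
  obtain k where k: "k > 0" "orlicz_modular M \<Phi> (\<lambda>x. complex_of_real k * f x) < \<infinity>"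
    using f by (auto simp: orlicz_functions_def)
  define d where "d = max c 1"
  have d: "d > 0" by (simp add: d_def)
  have "orlicz_modular M \<Phi> (\<lambda>x. complex_of_real (k / d) * g x)
      \<le> orlicz_modular M \<Phi> (\<lambda>x. complex_of_real k * f x)"
  proof (rule orlicz_modular_mono[OF \<Phi>])
    show "AE x in M. cmod (complex_of_real (k / d) * g x) \<le> cmod (complex_of_real k * f x)"
      using le
    proof eventually_elim
      case (elim x)
      have "cmod (g x) \<le> d * cmod (f x)"
        using elim mult_right_mono[of c d "cmod (f x)"] by (simp add: d_def)
      then have "k / d * cmod (g x) \<le> k / d * (d * cmod (f x))"
        using k d by (intro mult_left_mono) auto
      then show ?case
        using k d by (simp add: norm_mult norm_divide)
    qed
  qed
  with k d g show ?thesis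
    unfolding orlicz_functions_def by (auto intro!: exI[of _ "k / d"] elim: le_less_trans)
qed

lemma orlicz_functions_add:
  assumes \<Phi>: "young_function \<Phi>"
    and f: "f \<in> orlicz_functions M \<Phi>" and g: "g \<in> orlicz_functions M \<Phi>"
  shows "(\<lambda>x. f x + g x) \<in> orlicz_functions M \<Phi>"
proof -
  have "(\<lambda>x. - g x) \<in> orlicz_functions M \<Phi>"
    using g by (intro orlicz_functions_solid[OF \<Phi> g, where c = 1]) (auto dest: orlicz_functions_borel)
  from orlicz_functions_minus[OF \<Phi> f this] show ?thesis by simp
qed

lemma orlicz_modular_suminf_disjoint:
  assumes \<Phi>: "young_function \<Phi>" and [measurable]: "\<And>k. g k \<in> borel_measurable M"
    and disj: "\<And>x j k. j \<noteq> k \<Longrightarrow> g j x = 0 \<or> g k x = 0"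
  shows "orlicz_modular M \<Phi> (\<lambda>x. \<Sum>k. g k x) \<le> (\<Sum>k. orlicz_modular M \<Phi> (g k))"
proof -
  note [measurable] = young_function_measurable[OF \<Phi>]
  have "\<Phi> (cmod (\<Sum>k. g k x)) \<le> (\<Sum>k. \<Phi> (cmod (g k x)))" for x
  proof (cases "\<exists>j. g j x \<noteq> 0")
    case True
    then obtain j where j: "g j x \<noteq> 0" by blast
    then have "g k x = 0" if "k \<noteq> j" for k using disj[OF that, of x] by auto
    then have "(\<Sum>k. g k x) = g j x"
      using suminf_finite[of "{j}" "\<lambda>k. g k x"] by auto
    moreover have "\<Phi> (cmod (g j x)) \<le> (\<Sum>k. \<Phi> (cmod (g k x)))"
      using sum_le_suminf[of "\<lambda>k. \<Phi> (cmod (g k x))" "{j}"] by simp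
    ultimately show ?thesis by simp
  qed (simp add: young_function_zero[OF \<Phi>])
  then have "orlicz_modular M \<Phi> (\<lambda>x. \<Sum>k. g k x) \<le> (\<integral>\<^sup>+x. (\<Sum>k. \<Phi> (cmod (g k x))) \<partial>M)"
    unfolding orlicz_modular_def by (intro nn_integral_mono)
  also have "\<dots> = (\<Sum>k. orlicz_modular M \<Phi> (g k))"
    unfolding orlicz_modular_def by (intro nn_integral_suminf) measurable
  finally show ?thesis .
qed

text \<open>
  Modulars of disjointly supported functions add up, so the tail from \<open>n\<close> on, divided by
  \<open>2 * (1 / 2) ^ n\<close>, has modular at most \<open>\<Sum>k. (1 / 2) ^ Suc k = 1\<close>; convexity turns each
  factor \<open>(1 / 2) ^ Suc k\<close> into a bound on the corresponding modular.
\<close>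

lemma luxemburg_disjoint_series:
  assumes \<Phi>: "young_function \<Phi>" and [measurable]: "\<And>k. g k \<in> borel_measurable M"
    and disj: "\<And>x j k. j \<noteq> k \<Longrightarrow> g j x = 0 \<or> g k x = 0"
    and le_1: "\<And>k. orlicz_modular M \<Phi> (\<lambda>x. 2 ^ k * g k x) \<le> 1"
  shows "(\<lambda>x. \<Sum>k. g k x) \<in> orlicz_functions M \<Phi>"
    and "luxemburg_norm M \<Phi> (\<lambda>x. (\<Sum>k<n. g k x) - (\<Sum>k. g k x)) \<le> 2 * (1 / 2) ^ n"
proof -
  let ?mod = "orlicz_modular M \<Phi>"
  have summable: "summable (\<lambda>k. g k x)" for x
  proof (cases "\<exists>j. g j x \<noteq> 0")
    case True
    then obtain j where "g j x \<noteq> 0" by blast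
    then have "g k x = 0" if "k \<notin> {j}" for k using disj[of k j x] that by auto
    then show ?thesis by (intro summable_finite[of "{j}"]) auto
  qed simp
  have tail: "?mod (\<lambda>x. (\<Sum>k. g (k + n) x) / complex_of_real (2 * (1 / 2) ^ n)) \<le> 1" for n
  proof -
    let ?\<epsilon> = "complex_of_real (2 * (1 / 2) ^ n)"
    have "?mod (\<lambda>x. g (k + n) x / ?\<epsilon>) \<le> ennreal ((1 / 2) ^ Suc k)" for k
    proof -
      let ?e = "\<lambda>x. 2 ^ (k + n) * g (k + n) x"
      have "(\<lambda>x. g (k + n) x / ?\<epsilon>) = (\<lambda>x. complex_of_real ((1 / 2) ^ Suc k) * ?e x)"
        by (simp add: power_add power_divide mult_ac)
      then have "?mod (\<lambda>x. g (k + n) x / ?\<epsilon>) = ?mod (\<lambda>x. complex_of_real ((1 / 2) ^ Suc k) * ?e x)"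
        by (rule arg_cong)
      also have "\<dots> \<le> ennreal ((1 / 2) ^ Suc k) * ?mod ?e"
        by (intro orlicz_modular_scale[OF \<Phi>] power_le_one) auto
      also have "\<dots> \<le> ennreal ((1 / 2) ^ Suc k) * 1"
        by (intro mult_left_mono le_1) auto
      finally show ?thesis by simp
    qed
    then have sum_le: "(\<Sum>k. ?mod (\<lambda>x. g (k + n) x / ?\<epsilon>)) \<le> (\<Sum>k. ennreal ((1 / 2) ^ Suc k))"
      by (intro suminf_le) auto
    have "(\<lambda>x. (\<Sum>k. g (k + n) x) / ?\<epsilon>) = (\<lambda>x. \<Sum>k. g (k + n) x / ?\<epsilon>)"
      by (intro ext suminf_divide[symmetric] summable_ignore_initial_segment summable)
    then have "?mod (\<lambda>x. (\<Sum>k. g (k + n) x) / ?\<epsilon>) \<le> (\<Sum>k. ?mod (\<lambda>x. g (k + n) x / ?\<epsilon>))"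
      using orlicz_modular_suminf_disjoint[OF \<Phi>, of "\<lambda>k x. g (k + n) x / ?\<epsilon>" M] disj by simp
    also note sum_le
    also have "(\<Sum>k. ennreal ((1 / 2) ^ Suc k)) = ennreal 1"
      by (rule suminf_ennreal_eq[OF _ power_half_series]) (rule zero_le_power, simp)
    finally show ?thesis by (simp only: ennreal_1)
  qed
  show "(\<lambda>x. \<Sum>k. g k x) \<in> orlicz_functions M \<Phi>"
    using tail[of 0] unfolding orlicz_functions_def
    by (auto intro!: exI[of _ "1 / 2"] intro: le_less_trans[of _ 1])
  have "(\<Sum>k<n. g k x) - (\<Sum>k. g k x) = - (\<Sum>k. g (k + n) x)" for x
    using suminf_split_initial_segment[OF summable, of x n] by simp
  then have "?mod (\<lambda>x. ((\<Sum>k<n. g k x) - (\<Sum>k. g k x)) / complex_of_real (2 * (1 / 2) ^ n)) \<le> 1"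
    using tail[of n] by (simp add: orlicz_modular_def)
  then show "luxemburg_norm M \<Phi> (\<lambda>x. (\<Sum>k<n. g k x) - (\<Sum>k. g k x)) \<le> 2 * (1 / 2) ^ n"
    by (intro luxemburg_norm_le) auto
qed

text \<open>
  The multiple \<open>e / (2 r)\<close>, where \<open>r\<close> is the norm of \<open>e\<close>, has norm \<open>1 / 2\<close>. The factor 4 stays off the
  borderline case of norm one, where the modular may be strictly smaller than one.
\<close>

lemma orlicz_normalize:
  assumes \<Phi>: "young_function \<Phi>" and e: "e \<in> orlicz_functions M \<Phi>" and nz: "\<not> (AE x in M. e x = 0)"
  shows "\<exists>c>0. orlicz_modular M \<Phi> (\<lambda>x. complex_of_real c * e x) \<le> 1 \<and>
               orlicz_modular M \<Phi> (\<lambda>x. complex_of_real (4 * c) * e x) > 1"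
proof -
  define r where "r = luxemburg_norm M \<Phi> e"
  have r: "r > 0"
    using luxemburg_norm_nonneg[OF \<Phi> e] luxemburg_norm_eq_zeroD[OF \<Phi> e] nz by (auto simp: r_def less_le)
  have "orlicz_modular M \<Phi> (\<lambda>x. e x / complex_of_real (2 * r)) \<le> 1"
    using r by (intro luxemburg_norm_less[OF \<Phi> e]) (simp add: r_def)
  moreover have "\<not> orlicz_modular M \<Phi> (\<lambda>x. e x / complex_of_real (r / 2)) \<le> 1"
    using luxemburg_norm_le[of "r / 2" M \<Phi> e] r by (auto simp: r_def)
  ultimately show ?thesis
    using r by (intro exI[of _ "1 / (2 * r)"]) (auto simp: field_simps)
qed

section \<open>Weighted conditional type operators\<close>

text \<open>
  That \<open>T\<close> maps the Orlicz space into itself is stated here for functions rather than for classes, so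
  that all pointwise identities below can be derived before passing to classes.
\<close>

locale orlicz_wct = sigma_finite_subalgebra M A for M A :: "'a measure" +
  fixes \<Phi> :: "real \<Rightarrow> ennreal" and u w :: "'a \<Rightarrow> complex"
  assumes young: "young_function \<Phi>"
    and u_measurable [measurable]: "u \<in> borel_measurable M"
    and w_measurable [measurable]: "w \<in> borel_measurable M"
    and uw_defined: "cond_exp_defined M A (\<lambda>x. u x * w x)"
    and uf_defined: "f \<in> orlicz_functions M \<Phi> \<Longrightarrow> cond_exp_defined M A (\<lambda>x. u x * f x)"
    and wct_in_orlicz: "f \<in> orlicz_functions M \<Phi> \<Longrightarrow> wct M A w u f \<in> orlicz_functions M \<Phi>"
begin

abbreviation L where "L \<equiv> orlicz_functions M \<Phi>"
abbreviation T where "T \<equiv> wct M A w u"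

definition h where "h = complex_cond_exp M A (\<lambda>x. u x * w x)"

lemma h_measurable [measurable]: "h \<in> borel_measurable A" "h \<in> borel_measurable M"
  by (simp_all add: h_def)

lemma borel_measurable_of_sub: "\<phi> \<in> borel_measurable A \<Longrightarrow> \<phi> \<in> borel_measurable M"
  by (rule measurable_from_subalg[OF subalg])

lemma bounded_mult_in_orlicz:
  assumes "f \<in> L" "\<phi> \<in> borel_measurable M" "\<And>x. cmod (\<phi> x) \<le> c"
  shows "(\<lambda>x. \<phi> x * f x) \<in> L"
  using assms orlicz_functions_borel[OF assms(1)]
  by (intro orlicz_functions_solid[OF young assms(1), where c = c])
     (auto simp: norm_mult intro!: mult_right_mono)

lemma wct_add:
  assumes "f \<in> L" "g \<in> L"
  shows "AE x in M. T (\<lambda>x. f x + g x) x = T f x + T g x"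
  using complex_cond_exp_add[OF uf_defined[OF assms(1)] uf_defined[OF assms(2)]]
  by eventually_elim (simp add: wct_def distrib_left)

lemma wct_mult:
  assumes "f \<in> L" "\<phi> \<in> borel_measurable A"
  shows "AE x in M. T (\<lambda>x. \<phi> x * f x) x = \<phi> x * T f x"
  using complex_cond_exp_mult[OF assms(2) uf_defined[OF assms(1)]]
  by eventually_elim (simp add: wct_def mult_ac)

text \<open>The multiplier pulled out here is \<open>E(u f)\<close> itself: \<open>E(u w E(u f)) = E(u f) E(u w)\<close>.\<close>

lemma wct_wct: "AE x in M. T (T f) x = h x * T f x"
  using complex_cond_exp_mult[OF complex_cond_exp_measurable(1)[of M A "\<lambda>x. u x * f x"] uw_defined]
  by eventually_elim (simp add: wct_def h_def mult_ac)

lemma wct_op_squared: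
  assumes f: "f \<in> L"
  shows "(wct_op M A w u ^^ 2) (ae_class M f) = ae_class M (\<lambda>x. h x * T f x)"
proof -
  have "(wct_op M A w u ^^ 2) (ae_class M f) = ae_class M (T (T f))"
    using f wct_in_orlicz[OF f] wct_op_ae_class[OF sigma_finite_subalgebra_axioms u_measurable]
    by (simp add: numeral_2_eq_2 orlicz_functions_borel)
  also have "\<dots> = ae_class M (\<lambda>x. h x * T f x)"
    by (rule ae_class_eqI[OF wct_wct])
  finally show ?thesis .
qed

lemma range_squared:
  "orlicz_range M \<Phi> (wct_op M A w u ^^ 2) = (\<lambda>f. ae_class M (\<lambda>x. h x * T f x)) ` L"
  unfolding orlicz_range_def orlicz_space_def image_image
  by (intro image_cong refl wct_op_squared)

lemma wct_measurable [measurable]: "T f \<in> borel_measurable M"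
  unfolding wct_def by measurable

lemma null_squared:
  "orlicz_null M \<Phi> (wct_op M A w u ^^ 2) = ae_class M ` {f \<in> L. AE x in M. h x * T f x = 0}"
proof -
  have "ae_class M (\<lambda>x. h x * T f x) = ae_zero M \<longleftrightarrow> (AE x in M. h x * T f x = 0)" for f
    unfolding ae_zero_def by (rule ae_class_eq_iff) measurable
  then have "(wct_op M A w u ^^ 2) (ae_class M f) = ae_zero M \<longleftrightarrow> (AE x in M. h x * T f x = 0)" if "f \<in> L" for f
    using that by (simp only: wct_op_squared)
  then show ?thesis
    unfolding orlicz_null_def orlicz_space_def by blast
qed

lemma h_wct_in_orlicz:
  assumes f: "f \<in> L"
  shows "(\<lambda>x. h x * T f x) \<in> L"
proof (rule orlicz_functions_solid[OF young wct_in_orlicz[OF wct_in_orlicz[OF f]]])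
  show "AE x in M. cmod (h x * T f x) \<le> 1 * cmod (T (T f) x)"
    using wct_wct[of f] by eventually_elim simp
qed measurable

text \<open>
  If \<open>T\<^sup>2\<close> annihilates the element \<open>h T f\<close> of its range, then \<open>h\<^sup>3 T f = 0\<close>, hence \<open>h T f = 0\<close>.
\<close>

lemma range_inter_null:
  "orlicz_range M \<Phi> (wct_op M A w u ^^ 2) \<inter> orlicz_null M \<Phi> (wct_op M A w u ^^ 2) = {ae_zero M}"
proof -
  have "H = ae_zero M"
    if R: "H \<in> orlicz_range M \<Phi> (wct_op M A w u ^^ 2)" and N: "H \<in> orlicz_null M \<Phi> (wct_op M A w u ^^ 2)"
    for H
  proof -
    obtain f where f: "f \<in> L" and H: "H = ae_class M (\<lambda>x. h x * T f x)"
      using R unfolding range_squared by auto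
    have hf: "(\<lambda>x. h x * T f x) \<in> L" using f by (rule h_wct_in_orlicz)
    have "ae_class M (\<lambda>x. h x * T (\<lambda>x. h x * T f x) x) = ae_zero M"
      using N wct_op_squared[OF hf] by (simp add: orlicz_null_def H)
    then have "AE x in M. h x * T (\<lambda>x. h x * T f x) x = 0"
      unfolding ae_zero_def by (subst (asm) ae_class_eq_iff) auto
    with wct_mult[OF wct_in_orlicz[OF f] h_measurable(1)] wct_wct[of f]
    have "AE x in M. h x * T f x = 0"
      by eventually_elim auto
    then show ?thesis unfolding H ae_zero_def by (rule ae_class_eqI)
  qed
  moreover have "ae_zero M \<in> orlicz_range M \<Phi> (wct_op M A w u ^^ 2)"
    and "ae_zero M \<in> orlicz_null M \<Phi> (wct_op M A w u ^^ 2)"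
  proof -
    have z: "(\<lambda>x. 0) \<in> L" by (rule zero_in_orlicz_functions[OF young])
    have T0: "AE x in M. h x * T (\<lambda>x. 0) x = 0"
      using wct_mult[OF z, of "\<lambda>x. 0"] by (auto elim: eventually_mono)
    have "ae_zero M = ae_class M (\<lambda>x. h x * T (\<lambda>x. 0) x)"
      unfolding ae_zero_def using T0 by (intro ae_class_eqI) (auto elim: eventually_mono)
    with z show "ae_zero M \<in> orlicz_range M \<Phi> (wct_op M A w u ^^ 2)"
      unfolding range_squared by blast
    show "ae_zero M \<in> orlicz_null M \<Phi> (wct_op M A w u ^^ 2)"
      unfolding null_squared ae_zero_def using z T0 by blast
  qed
  ultimately show ?thesis by blast
qed

definition shell :: "nat \<Rightarrow> 'a set" where
  "shell k = {x \<in> space M. (1 / 4) ^ Suc k \<le> cmod (h x) \<and> cmod (h x) < (1 / 4) ^ k}"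

lemma indicator_shell_measurable [measurable]:
  "(\<lambda>x. indicator (shell k) x :: complex) \<in> borel_measurable A"
proof -
  have "shell k = {x \<in> space A. (1 / 4) ^ Suc k \<le> cmod (h x) \<and> cmod (h x) < (1 / 4) ^ k}"
    using subalg by (simp add: shell_def subalgebra_def)
  then have "shell k \<in> sets A" by simp
  then show ?thesis by simp
qed

lemma shell_disjoint:
  assumes "j \<noteq> k" "x \<in> shell j" shows "x \<notin> shell k"
proof
  assume "x \<in> shell k"
  have "\<not> (x \<in> shell i \<and> x \<in> shell j)" if "i < j" for i j
  proof -
    have "(1 / 4 :: real) ^ j \<le> (1 / 4) ^ Suc i" using that by (intro power_decreasing) auto
    then show ?thesis by (auto simp: shell_def)
  qed
  then show False using assms \<open>x \<in> shell k\<close> by (metis nat_neq_iff)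
qed

lemma shell_exhaust:
  assumes "x \<in> space M" "h x \<noteq> 0" "cmod (h x) < (1 / 4) ^ K"
  shows "\<exists>k\<ge>K. x \<in> shell k"
proof -
  obtain n where n: "(1 / 4) ^ n < cmod (h x)"
    using real_arch_pow_inv[of "cmod (h x)" "1 / 4"] assms by auto
  define m where "m = (LEAST n. (1 / 4) ^ n \<le> cmod (h x))"
  have m: "(1 / 4) ^ m \<le> cmod (h x)"
    unfolding m_def by (rule LeastI[of _ n]) (use n in simp)
  have "m > K"
  proof (rule ccontr)
    assume "\<not> m > K"
    then have "(1 / 4 :: real) ^ K \<le> (1 / 4) ^ m" by (intro power_decreasing) auto
    with m assms show False by simp
  qed
  then obtain k where k: "m = Suc k" "k \<ge> K" by (cases m) auto
  have "\<not> (1 / 4) ^ k \<le> cmod (h x)"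
    using not_less_Least[of k "\<lambda>n. (1 / 4) ^ n \<le> cmod (h x)"] k m_def by auto
  with k m assms show ?thesis by (auto simp: shell_def)
qed

lemma exists_normalized_image:
  assumes f: "f \<in> L" and [measurable]: "\<phi> \<in> borel_measurable A" and le: "\<And>x. cmod (\<phi> x) \<le> c"
    and nz: "\<not> (AE x in M. \<phi> x * T f x = 0)"
  shows "\<exists>g\<in>L. orlicz_modular M \<Phi> (\<lambda>x. \<phi> x * T g x) \<le> 1 \<and>
               orlicz_modular M \<Phi> (\<lambda>x. 4 * (\<phi> x * T g x)) > 1"
proof -
  let ?e = "\<lambda>x. \<phi> x * T f x"
  have "?e \<in> L"
    by (rule bounded_mult_in_orlicz[OF wct_in_orlicz[OF f] borel_measurable_of_sub le]) measurable
  then obtain a where a: "orlicz_modular M \<Phi> (\<lambda>x. complex_of_real a * ?e x) \<le> 1"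
    "orlicz_modular M \<Phi> (\<lambda>x. complex_of_real (4 * a) * ?e x) > 1"
    using orlicz_normalize[OF young _ nz] by blast
  let ?g = "\<lambda>x. complex_of_real a * f x"
  have Ta: "AE x in M. T ?g x = complex_of_real a * T f x"
    by (rule wct_mult[OF f]) simp
  have "orlicz_modular M \<Phi> (\<lambda>x. \<phi> x * T ?g x) = orlicz_modular M \<Phi> (\<lambda>x. complex_of_real a * ?e x)"
    using Ta by (intro orlicz_modular_cong) (auto elim!: eventually_mono)
  moreover have "orlicz_modular M \<Phi> (\<lambda>x. 4 * (\<phi> x * T ?g x))
      = orlicz_modular M \<Phi> (\<lambda>x. complex_of_real (4 * a) * ?e x)"
    using Ta by (intro orlicz_modular_cong) (auto elim!: eventually_mono)
  moreover have "?g \<in> L"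
    using f by (intro bounded_mult_in_orlicz[where c = "\<bar>a\<bar>"]) auto
  ultimately show ?thesis using a by (intro bexI[of _ ?g]) simp_all
qed

text \<open>
  The gliding hump: on the \<open>k\<close>-th shell \<open>\<bar>h\<bar>\<close> is below \<open>4\<^bsup>-k\<^esup>\<close>, so the hump \<open>2\<^bsup>k\<^esup> h T f\<^sub>k\<close> still has size
  at most \<open>2\<^bsup>-k\<^esup>\<close>, while a preimage of the sum of the humps would have to be mapped by \<open>T\<close> to a function
  of size \<open>2\<^bsup>k\<^esup>\<close> there.
\<close>

lemma wct_vanishes_on_late_shells:
  assumes closed: "closedin (orlicz_topology M \<Phi>) (orlicz_range M \<Phi> (wct_op M A w u ^^ 2))"
  shows "\<exists>K. \<forall>k\<ge>K. \<forall>f\<in>L. AE x in M. indicator (shell k) x * T f x = 0"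
proof (rule ccontr)
  let ?I = "\<lambda>k x. indicator (shell k) x :: complex"
  let ?mod = "orlicz_modular M \<Phi>"
  assume contra: "\<not> ?thesis"
  define bad where "bad k \<longleftrightarrow> (\<exists>f\<in>L. \<not> (AE x in M. ?I k x * T f x = 0))" for k
  have bad_inf: "\<exists>k\<ge>K. bad k" for K
    using contra by (auto simp: bad_def)
  have "\<exists>f\<in>L. ?mod (\<lambda>x. ?I k x * T f x) \<le> 1 \<and> (bad k \<longrightarrow> ?mod (\<lambda>x. 4 * (?I k x * T f x)) > 1)" for k
  proof (cases "bad k")
    case True
    then obtain f where f: "f \<in> L" "\<not> (AE x in M. ?I k x * T f x = 0)" by (auto simp: bad_def)
    have "cmod (?I k x) \<le> 1" for x by (simp split: split_indicator)
    then show ?thesis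
      using exists_normalized_image[OF f(1) indicator_shell_measurable _ f(2)] by blast
  next
    case False
    have z: "(\<lambda>x. 0) \<in> L" by (rule zero_in_orlicz_functions[OF young])
    have "AE x in M. ?I k x * T (\<lambda>x. 0) x = 0" using False z by (auto simp: bad_def)
    then have "?mod (\<lambda>x. ?I k x * T (\<lambda>x. 0) x) = ?mod (\<lambda>x. 0)"
      by (rule orlicz_modular_cong)
    also have "\<dots> = 0" by (simp add: orlicz_modular_def young_function_zero[OF young])
    finally show ?thesis using False z by (intro bexI[of _ "\<lambda>x. 0"]) simp_all
  qed
  then obtain f where fL: "\<And>k. f k \<in> L"
    and f_le: "\<And>k. ?mod (\<lambda>x. ?I k x * T (f k) x) \<le> 1"
    and f_gt: "\<And>k. bad k \<Longrightarrow> ?mod (\<lambda>x. 4 * (?I k x * T (f k) x)) > 1"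
    by metis
  define g where "g k x = h x * (2 ^ k * (?I k x * T (f k) x))" for k x
  have [measurable]: "?I k \<in> borel_measurable M" for k
    using borel_measurable_of_sub[OF indicator_shell_measurable] .
  have [measurable]: "g k \<in> borel_measurable M" for k
    unfolding g_def by measurable
  have disj: "g j x = 0 \<or> g k x = 0" if "j \<noteq> k" for j k x
    using shell_disjoint[OF that, of x] by (auto simp: g_def split: split_indicator)
  have g_le: "cmod (2 ^ k * g k x) \<le> cmod (?I k x * T (f k) x)" for k x
  proof (cases "x \<in> shell k")
    case True
    then have "cmod (h x) * 4 ^ k \<le> (1 / 4) ^ k * 4 ^ k"
      by (intro mult_right_mono) (auto simp: shell_def)
    then have "cmod (h x) * 4 ^ k \<le> 1" by (simp add: power_mult_distrib[symmetric])
    moreover have "(2 :: real) ^ k * 2 ^ k = 4 ^ k" by (simp add: power_mult_distrib[symmetric])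
    then have "cmod (2 ^ k * g k x) = (cmod (h x) * 4 ^ k) * cmod (?I k x * T (f k) x)"
      by (simp add: g_def norm_mult norm_power)
    ultimately show ?thesis
      by (simp only: mult_left_le_one_le norm_ge_zero mult_nonneg_nonneg zero_le_power zero_le_numeral)
  qed (simp add: g_def)
  have g_mod: "?mod (\<lambda>x. 2 ^ k * g k x) \<le> 1" for k
    using orlicz_modular_mono[OF young AE_I2[OF g_le]] f_le by (rule order_trans)
  define G where "G = (\<lambda>x. \<Sum>k. g k x)"
  have [measurable]: "G \<in> borel_measurable M" unfolding G_def by measurable
  have GL: "G \<in> L"
    unfolding G_def by (rule luxemburg_disjoint_series(1)[OF young _ disj g_mod]) measurable
  have partial: "\<exists>p\<in>L. AE x in M. h x * T p x = (\<Sum>k<n. g k x)" for n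
  proof (induction n)
    case 0
    have z: "(\<lambda>x. 0) \<in> L" by (rule zero_in_orlicz_functions[OF young])
    then show ?case
      using wct_mult[OF z, of "\<lambda>x. 0"] by (intro bexI[of _ "\<lambda>x. 0"]) (auto elim: eventually_mono)
  next
    case (Suc n)
    then obtain p where p: "p \<in> L" "AE x in M. h x * T p x = (\<Sum>k<n. g k x)" by blast
    let ?q = "\<lambda>x. (2 ^ n * ?I n x) * f n x"
    have q: "?q \<in> L"
      by (rule bounded_mult_in_orlicz[OF fL, of _ "2 ^ n"])
         (auto simp: norm_mult norm_power split: split_indicator)
    have "AE x in M. T ?q x = (2 ^ n * ?I n x) * T (f n) x"
      by (rule wct_mult[OF fL]) measurable
    with wct_add[OF p(1) q] p(2)
    have "AE x in M. h x * T (\<lambda>x. p x + ?q x) x = (\<Sum>k<Suc n. g k x)"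
      by eventually_elim (simp add: g_def distrib_left mult_ac)
    with orlicz_functions_add[OF young p(1) q] show ?case
      by (intro bexI[of _ "\<lambda>x. p x + ?q x"])
  qed
  interpret Metric_space "orlicz_space M \<Phi>" "orlicz_dist M \<Phi>"
    by (rule Metric_space_orlicz[OF young])
  let ?S = "\<lambda>n. ae_class M (\<lambda>x. \<Sum>k<n. g k x)"
  have S: "?S n \<in> orlicz_range M \<Phi> (wct_op M A w u ^^ 2)" "(\<lambda>x. \<Sum>k<n. g k x) \<in> L" for n
  proof -
    obtain p where p: "p \<in> L" "AE x in M. h x * T p x = (\<Sum>k<n. g k x)" using partial by blast
    have eq: "?S n = ae_class M (\<lambda>x. h x * T p x)"
      using p(2) by (intro ae_class_eqI) (auto elim: eventually_mono)
    then show "?S n \<in> orlicz_range M \<Phi> (wct_op M A w u ^^ 2)"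
      unfolding range_squared using p(1) by auto
    have "?S n \<in> orlicz_space M \<Phi>"
      unfolding eq using h_wct_in_orlicz[OF p(1)] by (simp add: orlicz_space_def)
    moreover have "(\<lambda>x. \<Sum>k<n. g k x) \<in> borel_measurable M" by measurable
    ultimately show "(\<lambda>x. \<Sum>k<n. g k x) \<in> L"
      by (simp only: ae_class_in_orlicz_space_iff)
  qed
  have dist_le: "orlicz_dist M \<Phi> (?S n) (ae_class M G) \<le> 2 * (1 / 2) ^ n" for n
    using luxemburg_disjoint_series(2)[OF young _ disj g_mod, of n]
    by (subst orlicz_dist_ae_class[OF S(2) GL]) (simp add: G_def)
  have "(\<lambda>n. 2 * (1 / 2 :: real) ^ n) \<longlonglongrightarrow> 0"
    by (intro tendsto_mult_right_zero LIMSEQ_power_zero) simp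
  then have "(\<lambda>n. orlicz_dist M \<Phi> (?S n) (ae_class M G)) \<longlonglongrightarrow> 0"
    by (rule tendsto_sandwich[OF _ _ tendsto_const, rotated 2]) (auto intro!: always_eventually dist_le)
  then have "limitin mtopology ?S (ae_class M G) sequentially"
    using imageI[OF S(2), of "ae_class M"] imageI[OF GL, of "ae_class M"]
    unfolding limitin_metric_dist_null orlicz_space_def[symmetric] by simp
  then have "ae_class M G \<in> orlicz_range M \<Phi> (wct_op M A w u ^^ 2)"
    using closed[unfolded orlicz_topology_def metric_closedin_iff_sequentially_closed]
      image_subsetI[of UNIV ?S, OF S(1)] by blast
  then obtain p where p: "p \<in> L" "AE x in M. G x = h x * T p x"
    unfolding range_squared by (auto simp: ae_class_eq_iff)
  obtain a where a: "a > 0" "?mod (\<lambda>x. T p x / complex_of_real a) \<le> 1"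
    using luxemburg_set_nonempty[OF young wct_in_orlicz[OF p(1)]] by blast
  obtain K where K: "4 * a < 2 ^ K"
    using real_arch_pow[of 2 "4 * a"] by auto
  obtain k where k: "k \<ge> K" "bad k" using bad_inf by blast
  have "4 * a \<le> 2 ^ k"
    using K power_increasing[OF k(1), of "2::real"] by linarith
  \<comment> \<open>The modular of \<open>T p / a\<close> is at most one, but on the \<open>k\<close>-th shell \<open>T p / a = 2\<^bsup>k\<^esup> T f\<^sub>k / a\<close>
      dominates \<open>4 T f\<^sub>k\<close>, whose modular exceeds one.\<close>
  have "?mod (\<lambda>x. 4 * (?I k x * T (f k) x)) \<le> ?mod (\<lambda>x. T p x / complex_of_real a)"
  proof (rule orlicz_modular_mono[OF young])
    show "AE x in M. cmod (4 * (?I k x * T (f k) x)) \<le> cmod (T p x / complex_of_real a)"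
      using p(2)
    proof eventually_elim
      case (elim x)
      show ?case
      proof (cases "x \<in> shell k")
        case True
        have "g j x = 0" if "j \<noteq> k" for j
          using shell_disjoint[of k j x] that True by (simp add: g_def)
        then have "G x = g k x"
          using suminf_finite[of "{k}" "\<lambda>k. g k x"] by (auto simp: G_def)
        moreover have "h x \<noteq> 0"
        proof -
          have "0 < (1 / 4 :: real) ^ Suc k" by (rule zero_less_power) simp
          also have "\<dots> \<le> cmod (h x)" using True unfolding shell_def by blast
          finally show ?thesis by simp
        qed
        ultimately have "T p x = 2 ^ k * T (f k) x"
          using elim True by (simp add: g_def)
        moreover have "4 * a * cmod (T (f k) x) \<le> 2 ^ k * cmod (T (f k) x)"
          by (intro mult_right_mono \<open>4 * a \<le> 2 ^ k\<close>) simp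
        ultimately show ?thesis
          using a True by (simp add: norm_mult norm_divide norm_power field_simps)
      qed simp
    qed
  qed
  with a f_gt[OF k(2)] show False by simp
qed

lemma wct_vanishes_near_zeros_of_h:
  assumes closed: "closedin (orlicz_topology M \<Phi>) (orlicz_range M \<Phi> (wct_op M A w u ^^ 2))"
  shows "\<exists>\<delta>>0. \<forall>f\<in>L. AE x in M. 0 < cmod (h x) \<and> cmod (h x) < \<delta> \<longrightarrow> T f x = 0"
proof -
  obtain K where K: "\<And>k f. k \<ge> K \<Longrightarrow> f \<in> L \<Longrightarrow> AE x in M. indicator (shell k) x * T f x = 0"
    using wct_vanishes_on_late_shells[OF closed] by blast
  have "AE x in M. 0 < cmod (h x) \<and> cmod (h x) < (1 / 4) ^ K \<longrightarrow> T f x = 0" if f: "f \<in> L" for f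
  proof -
    have "AE x in M. \<forall>k\<in>{K..}. indicator (shell k) x * T f x = 0"
      using K f by (intro AE_ball_countable[THEN iffD2]) auto
    then show ?thesis
    proof (rule AE_mp, intro AE_I2 impI)
      fix x assume "x \<in> space M" and *: "\<forall>k\<in>{K..}. indicator (shell k) x * T f x = 0"
        and "0 < cmod (h x) \<and> cmod (h x) < (1 / 4) ^ K"
      then obtain k where "k \<ge> K" "x \<in> shell k" using shell_exhaust[of x K] by auto
      with bspec[OF *, of k] show "T f x = 0" by (simp only: atLeast_iff indicator_simps) simp
    qed
  qed
  then show ?thesis by (intro exI[of _ "(1 / 4) ^ K"]) auto
qed

text \<open>
  Where \<open>\<bar>h\<bar> < \<delta>\<close>, either \<open>h = 0\<close> or \<open>T f = 0\<close>, so \<open>h T f\<close> vanishes there. For the cut-off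
  inverse \<open>\<phi>\<close> of \<open>h\<close> this yields \<open>h (1 - \<phi> h) T f = 0\<close>, that is, \<open>f - \<phi> T f\<close> lies in the null space.
  The other summand is \<open>\<phi> T f = h T (\<phi>\<^sup>3 T f)\<close>, an element of the range.
\<close>

lemma range_plus_null:
  assumes closed: "closedin (orlicz_topology M \<Phi>) (orlicz_range M \<Phi> (wct_op M A w u ^^ 2))"
  shows "{ae_plus M F G | F G. F \<in> orlicz_range M \<Phi> (wct_op M A w u ^^ 2) \<and>
                               G \<in> orlicz_null M \<Phi> (wct_op M A w u ^^ 2)} = orlicz_space M \<Phi>"
proof
  show "{ae_plus M F G | F G. F \<in> orlicz_range M \<Phi> (wct_op M A w u ^^ 2) \<and>
                               G \<in> orlicz_null M \<Phi> (wct_op M A w u ^^ 2)} \<subseteq> orlicz_space M \<Phi>"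
    unfolding range_squared null_squared
    by (auto simp: ae_plus_ae_class orlicz_functions_borel orlicz_space_def
        intro!: imageI orlicz_functions_add[OF young] h_wct_in_orlicz)
next
  obtain \<delta> where \<delta>: "\<delta> > 0"
    and van: "\<And>f. f \<in> L \<Longrightarrow> AE x in M. 0 < cmod (h x) \<and> cmod (h x) < \<delta> \<longrightarrow> T f x = 0"
    using wct_vanishes_near_zeros_of_h[OF closed] by blast
  define \<phi> where "\<phi> x = (if cmod (h x) \<ge> \<delta> then 1 / h x else 0)" for x
  have \<phi>_meas [measurable]: "\<phi> \<in> borel_measurable A" unfolding \<phi>_def by measurable
  have [measurable]: "\<phi> \<in> borel_measurable M" by (rule borel_measurable_of_sub) measurable
  have \<phi>_le: "cmod (\<phi> x) \<le> 1 / \<delta>" for x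
    using \<delta> by (auto simp: \<phi>_def norm_divide intro!: divide_left_mono mult_pos_pos)
  have "ae_class M f \<in> {ae_plus M F G | F G. F \<in> orlicz_range M \<Phi> (wct_op M A w u ^^ 2) \<and>
      G \<in> orlicz_null M \<Phi> (wct_op M A w u ^^ 2)}" if f: "f \<in> L" for f
  proof -
    note [measurable] = orlicz_functions_borel[OF f]
    note Tf = wct_in_orlicz[OF f]
    define g where "g = (\<lambda>x. \<phi> x * T f x)"
    have g: "g \<in> L" unfolding g_def by (rule bounded_mult_in_orlicz[OF Tf _ \<phi>_le]) measurable
    define g' where "g' = (\<lambda>x. - g x)"
    have g': "g' \<in> L" "\<And>x. g' x = - \<phi> x * T f x"
      using bounded_mult_in_orlicz[OF g, of "\<lambda>x. -1" 1] by (simp_all add: g'_def g_def)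
    note [measurable] = orlicz_functions_borel[OF g] orlicz_functions_borel[OF g'(1)]
    have "(\<lambda>x. \<phi> x ^ 3 * T f x) \<in> L"
      using \<phi>_le by (intro bounded_mult_in_orlicz[OF Tf, where c = "(1 / \<delta>) ^ 3"])
        (auto simp: norm_power intro!: power_mono simp del: power_divide)
    moreover have "ae_class M g = ae_class M (\<lambda>x. h x * T (\<lambda>x. \<phi> x ^ 3 * T f x) x)"
    proof (rule ae_class_eqI)
      have "AE x in M. T (\<lambda>x. \<phi> x ^ 3 * T f x) x = \<phi> x ^ 3 * T (T f) x"
        by (rule wct_mult[OF Tf]) measurable
      then show "AE x in M. g x = h x * T (\<lambda>x. \<phi> x ^ 3 * T f x) x"
        using wct_wct[of f]
        by eventually_elim (auto simp: g_def \<phi>_def power3_eq_cube)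
    qed
    ultimately have R: "ae_class M g \<in> orlicz_range M \<Phi> (wct_op M A w u ^^ 2)"
      unfolding range_squared by blast
    have "AE x in M. T (\<lambda>x. (- \<phi> x) * T f x) x = - \<phi> x * T (T f) x"
      by (rule wct_mult[OF Tf]) measurable
    then have "AE x in M. T g' x = - \<phi> x * T (T f) x" by (simp add: g'(2)[abs_def])
    with wct_add[OF f g'(1)] wct_wct[of f] van[OF f]
    have "AE x in M. h x * T (\<lambda>x. f x + g' x) x = 0"
    proof eventually_elim
      case (elim x)
      then have "T (\<lambda>x. f x + g' x) x = (1 - \<phi> x * h x) * T f x" by (simp add: algebra_simps)
      then show ?case using elim(3) \<delta> by (cases "cmod (h x) \<ge> \<delta>") (auto simp: \<phi>_def)
    qed
    then have N: "ae_class M (\<lambda>x. f x + g' x) \<in> orlicz_null M \<Phi> (wct_op M A w u ^^ 2)"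
      unfolding null_squared using orlicz_functions_add[OF young f g'(1)] by blast
    have "ae_plus M (ae_class M g) (ae_class M (\<lambda>x. f x + g' x)) = ae_class M f"
      by (subst ae_plus_ae_class) (auto simp: g'_def)
    with R N show ?thesis by (metis (mono_tags, lifting) mem_Collect_eq)
  qed
  then show "orlicz_space M \<Phi> \<subseteq> {ae_plus M F G | F G. F \<in> orlicz_range M \<Phi> (wct_op M A w u ^^ 2) \<and>
                               G \<in> orlicz_null M \<Phi> (wct_op M A w u ^^ 2)}"
    unfolding orlicz_space_def by blast
qed

end

theorem theorem2p14:
  fixes M A :: "'a measure"
    and \<Phi> :: "real \<Rightarrow> ennreal"
    and u w :: "'a \<Rightarrow> complex"
  assumes "complete_measure M"
    and "sigma_finite_measure M"
    and "sigma_finite_subalgebra M A"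
    and "young_function \<Phi>"
    and "u \<in> borel_measurable M"
    and "w \<in> borel_measurable M"
    and "cond_exp_defined M A (\<lambda>x. u x * w x)"
    and "\<And>f. f \<in> orlicz_functions M \<Phi> \<Longrightarrow> cond_exp_defined M A (\<lambda>x. u x * f x)"
    and "bounded_on_orlicz M \<Phi> (wct_op M A w u)"
    and "closedin (orlicz_topology M \<Phi>) (orlicz_range M \<Phi> (wct_op M A w u ^^ 2))"
  shows "orlicz_range M \<Phi> (wct_op M A w u ^^ 2) \<inter> orlicz_null M \<Phi> (wct_op M A w u ^^ 2)
           = {ae_zero M} \<and>
         orlicz_topology M \<Phi> closure_of
           {ae_plus M F G | F G. F \<in> orlicz_range M \<Phi> (wct_op M A w u ^^ 2) \<and>
                                 G \<in> orlicz_null M \<Phi> (wct_op M A w u ^^ 2)}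
           = orlicz_space M \<Phi>"
proof -
  interpret sigma_finite_subalgebra M A by fact
  have T: "wct M A w u f \<in> orlicz_functions M \<Phi>" if f: "f \<in> orlicz_functions M \<Phi>" for f
  proof -
    have "wct_op M A w u (ae_class M f) \<in> orlicz_space M \<Phi>"
      using assms(9) f by (auto simp: bounded_on_orlicz_def orlicz_space_def)
    moreover have "wct M A w u f \<in> borel_measurable M"
      unfolding wct_def using assms(6) by measurable
    ultimately show ?thesis
      using wct_op_ae_class[OF assms(3,5) orlicz_functions_borel[OF f], of w]
      by (simp add: ae_class_in_orlicz_space_iff)
  qed
  interpret orlicz_wct M A \<Phi> u w
    by unfold_locales (fact assms T)+
  interpret Metric_space "orlicz_space M \<Phi>" "orlicz_dist M \<Phi>"
    by (rule Metric_space_orlicz[OF assms(4)])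
  have "orlicz_topology M \<Phi> closure_of orlicz_space M \<Phi> = orlicz_space M \<Phi>"
    using closure_of_topspace[of mtopology] by (simp add: orlicz_topology_def)
  then show ?thesis
    using range_inter_null range_plus_null[OF assms(10)] by simp
qed

end
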